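(* Let $\varphi$ be an increasing concave function on $[0,1]$ with $\varphi(0)=0$ and $\delta_\varphi<1$, and let $w$ be a non-trivial weight on $[0,1]$ with associated sequence $(w_r)_{r\ge1}$ (defined in the context). Put $\tilde\varphi(t)=t/\varphi(t)$ for $0<t\le1$. Then the Marcinkiewicz space $M_\varphi$ is $w$-decomposable if and only if there exists $C>0$ such that for every sequence of reals $(\tau_r)_{r=1}^\infty$ with $0<\tau_r\le w_r$ ($r\in\mathbb N$), $$C^{-1}\tilde\varphi\Big(\sum_{r=1}^\infty\tau_r\Big)\le\sum_{r=1}^\infty\tilde\varphi(\tau_r)\le C\,\tilde\varphi\Big(\sum_{r=1}^\infty\tau_r\Big).$$
   Context: $m$ is Lebesgue measure; functions are identified if they agree a.e., and $\operatorname{supp}x$ and infima/suprema of $w$ over sets are understood up to null sets. For measurable $x$ on $[0,1]$, $x^*(t)=\inf\{\lambda>0: m\{|x|>\lambda\}\le t\}$ and $x^{**}(t)=\frac1t\int_0^tx^*(s)\,ds$. The Marcinkiewicz space $M_\varphi$ consists of measurable $x$ on $[0,1]$ with $\|x\|_{M_\varphi}=\sup_{0<t\le1}\varphi(t)x^{**}(t)<\infty$. The upper dilation index is $\delta_\varphi=\lim_{t\to\infty}\frac{\ln\bar\varphi(t)}{\ln t}$, where $\bar\varphi(t)=\sup\{\varphi(st)/\varphi(s): s,st\in(0,1]\}$. A weight on $[0,1]$ is a measurable function that is positive and finite a.e.; it is non-trivial if $w$ or $1/w$ is unbounded. For the weight $w$ put $M_k=\{t\in[0,1]: w(t)\in[2^k,2^{k+1})\}$,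 $k\in\mathbb Z$; $(w_r)_{r=1}^\infty$ is the non-increasing rearrangement of $(m(M_k))_{k\in\mathbb Z}$ (all $w_r>0$ because $w$ is non-trivial). A space $X$ of functions is $w$-decomposable if there is $C>0$ such that for every $n\in\mathbb N$ and all nonzero $x_1,\dots,x_n,y_1,\dots,y_n\in X$ with $\|x_i\|_X=\|y_i\|_X$ ($1\le i\le n$) and $\inf w(\operatorname{supp}x_i\cup\operatorname{supp}y_i)\ge 2\sup w(\operatorname{supp}x_{i+1}\cup\operatorname{supp}y_{i+1})$ ($1\le i\le n-1$), one has $C^{-1}\|\sum_{i=1}^n x_i\|_X\le\|\sum_{i=1}^n y_i\|_X\le C\|\sum_{i=1}^n x_i\|_X$. *)

theory Defs
  imports "HOL-Probability.Essential_Supremum"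
begin

text \<open>
  Functions on \<open>[0,1]\<close> are represented by total functions on the reals whose values
  outside \<open>[0,1]\<close> are ignored. Functions are not formally quotiented by a.e. equality;
  every notion below depends only on the a.e. class.
\<close>

definition decr_rearrangement :: "(real \<Rightarrow> real) \<Rightarrow> real \<Rightarrow> ennreal" where
  "decr_rearrangement x t =
     (INF l \<in> {l. 0 < l \<and> emeasure lebesgue {u \<in> {0..1}. l < \<bar>x u\<bar>} \<le> ennreal t}. ennreal l)"

definition max_rearrangement :: "(real \<Rightarrow> real) \<Rightarrow> real \<Rightarrow> ennreal" where
  "max_rearrangement x t =
     (\<integral>\<^sup>+ s \<in> {0..t}. decr_rearrangement x s \<partial>lborel) / ennreal t"

definition marcinkiewicz_norm :: "(real \<Rightarrow> real) \<Rightarrow> (real \<Rightarrow> real) \<Rightarrow> ennreal" where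
  "marcinkiewicz_norm \<phi> x = (SUP t \<in> {0<..1}. ennreal (\<phi> t) * max_rearrangement x t)"

definition marcinkiewicz_space :: "(real \<Rightarrow> real) \<Rightarrow> (real \<Rightarrow> real) set" where
  "marcinkiewicz_space \<phi> =
     {x \<in> borel_measurable (lebesgue_on {0..1}). marcinkiewicz_norm \<phi> x < \<infinity>}"

definition dilation_function :: "(real \<Rightarrow> real) \<Rightarrow> real \<Rightarrow> real" where
  "dilation_function \<phi> t =
     Sup {\<phi> (s * t) / \<phi> s | s. s \<in> {0<..1} \<and> s * t \<in> {0<..1}}"

definition upper_dilation_index :: "(real \<Rightarrow> real) \<Rightarrow> real" where
  "upper_dilation_index \<phi> = Lim at_top (\<lambda>t. ln (dilation_function \<phi> t) / ln t)"

definition weight :: "(real \<Rightarrow> real) \<Rightarrow> bool" where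
  "weight w \<longleftrightarrow>
     w \<in> borel_measurable (lebesgue_on {0..1}) \<and> (AE t in lebesgue_on {0..1}. 0 < w t)"

definition ess_bounded_above :: "(real \<Rightarrow> real) \<Rightarrow> bool" where
  "ess_bounded_above f \<longleftrightarrow> (\<exists>B. AE t in lebesgue_on {0..1}. f t \<le> B)"

definition nontrivial_weight :: "(real \<Rightarrow> real) \<Rightarrow> bool" where
  "nontrivial_weight w \<longleftrightarrow>
     weight w \<and> (\<not> ess_bounded_above w \<or> \<not> ess_bounded_above (\<lambda>t. 1 / w t))"

definition level_set :: "(real \<Rightarrow> real) \<Rightarrow> int \<Rightarrow> real set" where
  "level_set w k = {t \<in> {0..1}. w t \<in> {2 powi k ..< 2 powi (k + 1)}}"

text \<open>
  The non-increasing rearrangement of a family \<open>a\<close> of non-negative reals tending to \<open>0\<close>,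
  indexed from \<open>0\<close>: \<open>seq_rearrangement a r\<close> is the \<open>(r+1)\<close>-st largest value, counted with
  multiplicity. If infinitely many \<open>a k\<close> are positive, it enumerates exactly the positive
  values.
\<close>

definition seq_rearrangement :: "('i \<Rightarrow> real) \<Rightarrow> nat \<Rightarrow> real" where
  "seq_rearrangement a r =
     Inf {l. 0 \<le> l \<and> finite {k. l < a k} \<and> card {k. l < a k} \<le> r}"

text \<open>In the usual indexing from \<open>1\<close>, \<open>weight_seq w r\<close> is the term with index \<open>r+1\<close>.\<close>

definition weight_seq :: "(real \<Rightarrow> real) \<Rightarrow> nat \<Rightarrow> real" where
  "weight_seq w = seq_rearrangement (\<lambda>k. measure lebesgue (level_set w k))"

definition supp :: "(real \<Rightarrow> real) \<Rightarrow> real set" where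
  "supp x = {t \<in> {0..1}. x t \<noteq> 0}"

definition ess_sup_on :: "real set \<Rightarrow> (real \<Rightarrow> real) \<Rightarrow> ereal" where
  "ess_sup_on A w = esssup (lebesgue_on A) (\<lambda>t. ereal (w t))"

definition ess_inf_on :: "real set \<Rightarrow> (real \<Rightarrow> real) \<Rightarrow> ereal" where
  "ess_inf_on A w = - esssup (lebesgue_on A) (\<lambda>t. - ereal (w t))"

definition nonzero_fun :: "(real \<Rightarrow> real) \<Rightarrow> bool" where
  "nonzero_fun x \<longleftrightarrow> \<not> (AE t in lebesgue_on {0..1}. x t = 0)"

definition w_decomposable ::
  "(real \<Rightarrow> real) \<Rightarrow> (real \<Rightarrow> real) set \<Rightarrow> ((real \<Rightarrow> real) \<Rightarrow> ennreal) \<Rightarrow> bool" where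
  "w_decomposable w X N \<longleftrightarrow>
     (\<exists>C::real. 0 < C \<and>
       (\<forall>n\<ge>1. \<forall>x y :: nat \<Rightarrow> real \<Rightarrow> real.
          (\<forall>i\<in>{1..n}. x i \<in> X \<and> y i \<in> X \<and> nonzero_fun (x i) \<and> nonzero_fun (y i) \<and>
                      N (x i) = N (y i)) \<longrightarrow>
          (\<forall>i\<in>{1..<n}. 2 * ess_sup_on (supp (x (i + 1)) \<union> supp (y (i + 1))) w
                        \<le> ess_inf_on (supp (x i) \<union> supp (y i)) w) \<longrightarrow>
          ennreal (1 / C) * N (\<lambda>t. \<Sum>i=1..n. x i t) \<le> N (\<lambda>t. \<Sum>i=1..n. y i t) \<and>
          N (\<lambda>t. \<Sum>i=1..n. y i t) \<le> ennreal C * N (\<lambda>t. \<Sum>i=1..n. x i t)))"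

definition tilde :: "(real \<Rightarrow> real) \<Rightarrow> real \<Rightarrow> real" where
  "tilde \<phi> t = t / \<phi> t"

end

theory Submission
  imports Defs "HOL-Probability.Probability_Measure"
begin

text \<open>
  Write \<open>\<psi> t = t / \<phi> t\<close>, which is nondecreasing and subadditive. The Marcinkiewicz norm of \<open>x\<close>
  is the supremum of \<open>(\<integral>A. \<bar>x\<bar>) / \<psi> (m A)\<close> over measurable sets \<open>A\<close>, by the layer cake formula.

  If the sum condition holds and the \<open>x i\<close>, \<open>y i\<close> live on sets \<open>S i\<close> separated by the weight, then
  each level set of \<open>w\<close> meets only one \<open>S i\<close>, so \<open>\<Sum>i. \<psi> (m (A \<inter> S i))\<close> is controlled by \<open>\<psi> (m A)\<close>.
  Since \<open>\<parallel>y i\<parallel> = \<parallel>x i\<parallel> \<le> \<parallel>\<Sum>j. x j\<parallel>\<close>, this bounds the integral of \<open>\<bar>\<Sum>i. y i\<bar>\<close> over every \<open>A\<close>.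

  Conversely, take finitely many levels of equal parity, so that their level sets are separated, and
  let \<open>y i\<close> be the normalized indicator of a set of measure \<open>\<tau> i\<close> in the \<open>i\<close>-th level set. The
  norm of \<open>\<Sum>i. y i\<close> is at least \<open>(\<Sum>i. \<psi> (\<tau> i)) / \<psi> (\<Sum>i. \<tau> i)\<close>. Decomposability compares it with
  normalized indicators of sets of geometrically decreasing measure, and the sum of those has norm
  bounded independently of their number because the dilation index is less than \<open>1\<close>. The lower bound
  in the sum condition is subadditivity of \<open>\<psi>\<close>.
\<close>

section \<open>Lebesgue measure on the unit interval and layer cakes\<close>

abbreviation unit_leb :: "real measure" where
  "unit_leb \<equiv> lebesgue_on {0..1}"

interpretation unit_leb: prob_space unit_leb
  by (rule prob_spaceI) (simp add: emeasure_restrict_space)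

lemma emeasure_unit_leb:
  assumes "A \<subseteq> {0..1}"
  shows "emeasure unit_leb A = emeasure lebesgue A"
  using assms by (simp add: emeasure_restrict_space)

lemma measure_unit_leb:
  assumes "A \<subseteq> {0..1}"
  shows "measure unit_leb A = measure lebesgue A"
  using assms by (simp add: measure_def emeasure_unit_leb)

lemma sets_unit_lebD:
  assumes "A \<in> sets unit_leb"
  shows "A \<in> sets lebesgue" "A \<subseteq> {0..1}"
  using assms by (auto simp: sets_restrict_space)

lemma sets_unit_lebI:
  assumes "A \<in> sets lebesgue" "A \<subseteq> {0..1}"
  shows "A \<in> sets unit_leb"
  using assms by (auto simp: sets_restrict_space)

text \<open>Lebesgue measure has no atoms: the sets \<open>E \<union> (F \<inter> {..c})\<close>
  sweep from \<open>E\<close> to \<open>F\<close>, their measure is 1-Lipschitz in \<open>c\<close>,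
  and the intermediate value theorem supplies the cut. This later produces sets of prescribed
  measure inside level sets.\<close>

lemma exists_intermediate_measure:
  assumes E: "E \<in> sets unit_leb" and F: "F \<in> sets unit_leb" and "E \<subseteq> F"
    and t: "measure unit_leb E \<le> t" "t \<le> measure unit_leb F"
  shows "\<exists>A\<in>sets unit_leb. E \<subseteq> A \<and> A \<subseteq> F \<and> measure unit_leb A = t"
proof -
  define G where "G c = E \<union> (F \<inter> {..c})" for c :: real
  define g where "g c = measure unit_leb (G c)" for c
  have F01: "F \<subseteq> {0..1}" using sets_unit_lebD(2)[OF F] .
  have Gs: "G c \<in> sets unit_leb" for c
  proof -
    have "F \<inter> {..c} \<in> sets unit_leb"
      using sets_unit_lebD[OF F] by (intro sets_unit_lebI) auto
    then show ?thesis unfolding G_def using E by blast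
  qed
  have step: "g c \<le> g d" "g d \<le> g c + (d - c)" if "c \<le> d" for c d
  proof -
    show "g c \<le> g d" unfolding g_def
      by (rule unit_leb.finite_measure_mono[OF _ Gs]) (use that in \<open>auto simp: G_def\<close>)
    have s: "{c<..d} \<inter> {0..1} \<in> sets unit_leb"
      by (intro sets_unit_lebI) auto
    have "g d \<le> measure unit_leb (G c \<union> ({c<..d} \<inter> {0..1}))" unfolding g_def
      by (rule unit_leb.finite_measure_mono[OF _ sets.Un[OF Gs s]]) (use F01 in \<open>auto simp: G_def\<close>)
    also have "\<dots> \<le> g c + measure unit_leb ({c<..d} \<inter> {0..1})" unfolding g_def
      by (rule measure_Un_le[OF Gs s])
    also have "measure unit_leb ({c<..d} \<inter> {0..1}) = measure lebesgue ({c<..d} \<inter> {0..1})"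
      by (rule measure_unit_leb) auto
    also have "\<dots> \<le> measure lebesgue {c..d}"
      by (rule measure_mono_fmeasurable) auto
    also have "\<dots> = d - c" using that by simp
    finally show "g d \<le> g c + (d - c)" by simp
  qed
  have "1-lipschitz_on UNIV g"
  proof (rule lipschitz_onI)
    fix c d :: real
    show "dist (g c) (g d) \<le> 1 * dist c d"
      using step[of c d] step[of d c] by (cases "c \<le> d") (auto simp: dist_real_def)
  qed simp
  then have "continuous_on {-1..1} g"
    by (meson continuous_on_subset lipschitz_on_continuous_on subset_UNIV)
  \<comment> \<open>The sweep starts at \<open>-1\<close> because at \<open>0\<close> the point
    \<open>0\<close> of \<open>F\<close> might already have been added.\<close>
  moreover have "G (-1) = E" "G 1 = F"
    using F01 \<open>E \<subseteq> F\<close> by (force simp: G_def)+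
  then have "g (-1) \<le> t" "t \<le> g 1" using t by (simp_all add: g_def)
  ultimately obtain c where "g c = t"
    using IVT'[of g "-1" t 1] by auto
  then show ?thesis using Gs[of c] \<open>E \<subseteq> F\<close>
    by (intro bexI[of _ "G c"]) (auto simp: g_def G_def)
qed

text \<open>The value \<open>f x\<close> is the length of
  \<open>{l. 0 \<le> l \<and> ennreal l < f x}\<close>, and Tonelli exchanges the two integrations.
  Values are extended because the rearrangement of an essentially unbounded function is infinite at
  \<open>0\<close>.\<close>

lemma nn_integral_layer_cake:
  fixes f :: "'a \<Rightarrow> ennreal"
  assumes "sigma_finite_measure M" and f[measurable]: "f \<in> borel_measurable M"
  shows "(\<integral>\<^sup>+ x. f x \<partial>M) =
    (\<integral>\<^sup>+ l. emeasure M {x \<in> space M. ennreal l < f x} * indicator {0..} l \<partial>lborel)"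
proof -
  interpret M: sigma_finite_measure M by fact
  interpret P: pair_sigma_finite lborel M ..
  have *: "emeasure lborel {l. 0 \<le> l \<and> ennreal l < c} = c" for c
  proof (cases c)
    case (real r)
    then have "{l. 0 \<le> l \<and> ennreal l < c} = {0..<r}"
      by (auto simp: ennreal_less_iff)
    with real show ?thesis by simp
  next
    case top
    then have "{l. 0 \<le> l \<and> ennreal l < c} = {0..}" by auto
    moreover have "emeasure lborel {0::real..} = \<infinity>"
    proof (rule ccontr)
      assume "emeasure lborel {0::real..} \<noteq> \<infinity>"
      then obtain b where b: "b \<ge> 0" "emeasure lborel {0::real..} = ennreal b"
        by (metis ennreal_cases infinity_ennreal_def)
      have "emeasure lborel {0..b + 1} \<le> emeasure lborel {0::real..}"
        by (rule emeasure_mono) auto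
      then have "ennreal (b + 1) \<le> ennreal b" using b by simp
      then show False using b(1) by (simp add: ennreal_le_iff)
    qed
    ultimately show ?thesis using top by simp
  qed
  have "(\<integral>\<^sup>+ l. emeasure M {x \<in> space M. ennreal l < f x} * indicator {0..} l \<partial>lborel)
      = (\<integral>\<^sup>+ l. (\<integral>\<^sup>+ x. indicator {(l, x). 0 \<le> l \<and> ennreal l < f x} (l, x) \<partial>M) \<partial>lborel)"
  proof (rule nn_integral_cong)
    fix l :: real
    have "emeasure M {x \<in> space M. ennreal l < f x} * indicator {0..} l =
        (\<integral>\<^sup>+ x. indicator {x \<in> space M. ennreal l < f x} x * indicator {0..} l \<partial>M)"
      by (subst nn_integral_multc) auto
    also have "\<dots> = (\<integral>\<^sup>+ x. indicator {(l, x). 0 \<le> l \<and> ennreal l < f x} (l, x) \<partial>M)"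
      by (rule nn_integral_cong) (auto split: split_indicator)
    finally show "emeasure M {x \<in> space M. ennreal l < f x} * indicator {0..} l = \<dots>" .
  qed
  also have "\<dots> = (\<integral>\<^sup>+ x. (\<integral>\<^sup>+ l. indicator {(l, x). 0 \<le> l \<and> ennreal l < f x} (l, x) \<partial>lborel) \<partial>M)"
  proof (rule P.Fubini'[symmetric])
    show "(\<lambda>(l, x). indicator {(l, x). 0 \<le> l \<and> ennreal l < f x} (l, x))
        \<in> borel_measurable (lborel \<Otimes>\<^sub>M M)"
    proof -
      have "Measurable.pred (lborel \<Otimes>\<^sub>M M) (\<lambda>p. 0 \<le> fst p \<and> ennreal (fst p) < f (snd p))"
        by measurable
      then have "(\<lambda>p. if 0 \<le> fst p \<and> ennreal (fst p) < f (snd p) then 1 else 0 :: ennreal)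
          \<in> borel_measurable (lborel \<Otimes>\<^sub>M M)"
        by measurable
      moreover have "(\<lambda>(l, x). indicator {(l, x). 0 \<le> l \<and> ennreal l < f x} (l, x)) =
          (\<lambda>p. if 0 \<le> fst p \<and> ennreal (fst p) < f (snd p) then 1 else 0 :: ennreal)"
        by (simp add: fun_eq_iff indicator_def case_prod_beta)
      ultimately show ?thesis by simp
    qed
  qed
  also have "\<dots> = (\<integral>\<^sup>+ x. f x \<partial>M)"
  proof (rule nn_integral_cong)
    fix x
    have "(\<integral>\<^sup>+ l. indicator {(l, x). 0 \<le> l \<and> ennreal l < f x} (l, x) \<partial>lborel) =
        (\<integral>\<^sup>+ l. indicator {l. 0 \<le> l \<and> ennreal l < f x} l \<partial>lborel)"
      by (rule nn_integral_cong) (auto split: split_indicator)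
    also have "\<dots> = f x"
      by (subst nn_integral_indicator) (auto simp: *)
    finally show "(\<integral>\<^sup>+ l. indicator {(l, x). 0 \<le> l \<and> ennreal l < f x} (l, x) \<partial>lborel) = f x" .
  qed
  finally show ?thesis by simp
qed

text \<open>At levels \<open>l \<ge> 0\<close> the function \<open>\<bar>x\<bar>\<close> cut off
  outside \<open>A\<close> can exceed \<open>l\<close> only on \<open>A\<close>.\<close>

lemma set_nn_integral_layer_cake:
  assumes [measurable]: "x \<in> borel_measurable unit_leb" and A[measurable]: "A \<in> sets unit_leb"
  shows "(\<integral>\<^sup>+ u\<in>A. ennreal \<bar>x u\<bar> \<partial>unit_leb) =
    (\<integral>\<^sup>+ l. emeasure unit_leb (A \<inter> {u \<in> {0..1}. l < \<bar>x u\<bar>}) * indicator {0..} l \<partial>lborel)"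
proof -
  have "(\<integral>\<^sup>+ u\<in>A. ennreal \<bar>x u\<bar> \<partial>unit_leb) =
    (\<integral>\<^sup>+ l. emeasure unit_leb {u \<in> space unit_leb. ennreal l < ennreal \<bar>x u\<bar> * indicator A u}
        * indicator {0..} l \<partial>lborel)"
    by (rule nn_integral_layer_cake[OF unit_leb.sigma_finite_measure_axioms]) measurable
  also have "\<dots> = (\<integral>\<^sup>+ l. emeasure unit_leb (A \<inter> {u \<in> {0..1}. l < \<bar>x u\<bar>})
      * indicator {0..} l \<partial>lborel)"
  proof (rule nn_integral_cong)
    fix l :: real
    show "emeasure unit_leb {u \<in> space unit_leb. ennreal l < ennreal \<bar>x u\<bar> * indicator A u}
        * indicator {0..} l =
        emeasure unit_leb (A \<inter> {u \<in> {0..1}. l < \<bar>x u\<bar>}) * indicator {0..} l"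
    proof (cases "0 \<le> l")
      case True
      then have "{u \<in> space unit_leb. ennreal l < ennreal \<bar>x u\<bar> * indicator A u} =
          A \<inter> {u \<in> {0..1}. l < \<bar>x u\<bar>}"
        by (auto simp: ennreal_less_iff split: split_indicator)
      then show ?thesis by simp
    qed simp
  qed
  finally show ?thesis .
qed

text \<open>The distribution function is right-continuous, which turns the infimum defining the
  rearrangement into a strict threshold.\<close>

lemma less_decr_rearrangement_iff:
  assumes [measurable]: "x \<in> borel_measurable unit_leb" and "0 \<le> l"
  shows "ennreal l < decr_rearrangement x s \<longleftrightarrow>
    ennreal s < emeasure unit_leb {u \<in> {0..1}. l < \<bar>x u\<bar>}"
proof
  assume *: "ennreal l < decr_rearrangement x s"
  show "ennreal s < emeasure unit_leb {u \<in> {0..1}. l < \<bar>x u\<bar>}"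
  proof (rule ccontr)
    assume "\<not> ?thesis"
    then have le: "emeasure unit_leb {u \<in> {0..1}. l < \<bar>x u\<bar>} \<le> ennreal s" by simp
    \<comment> \<open>The infimum runs over positive levels and \<open>l\<close> may be
      \<open>0\<close>, so the bound is taken at \<open>l + e\<close>, with \<open>e\<close>
      arbitrarily small.\<close>
    have "decr_rearrangement x s \<le> ennreal (l + e)" if "0 < e" for e
    proof -
      have "emeasure unit_leb {u \<in> {0..1}. l + e < \<bar>x u\<bar>} \<le>
          emeasure unit_leb {u \<in> {0..1}. l < \<bar>x u\<bar>}"
      proof (rule emeasure_mono)
        have "{u \<in> space unit_leb. l < \<bar>x u\<bar>} \<in> sets unit_leb" by measurable
        then show "{u \<in> {0..1}. l < \<bar>x u\<bar>} \<in> sets unit_leb" by simp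
      qed (use that in auto)
      with le have "emeasure lebesgue {u \<in> {0..1}. l + e < \<bar>x u\<bar>} \<le> ennreal s"
        by (subst emeasure_unit_leb[symmetric]) auto
      then show ?thesis unfolding decr_rearrangement_def
        using that \<open>0 \<le> l\<close> by (intro INF_lower) auto
    qed
    then have eps: "decr_rearrangement x s \<le> ennreal l + ennreal e" if "0 < e" for e
      using that \<open>0 \<le> l\<close> by (simp add: ennreal_plus[symmetric] del: ennreal_plus)
    have "decr_rearrangement x s \<le> ennreal l"
      by (rule ennreal_le_epsilon) (rule eps)
    with * show False by simp
  qed
next
  assume *: "ennreal s < emeasure unit_leb {u \<in> {0..1}. l < \<bar>x u\<bar>}"
  \<comment> \<open>These sets increase to \<open>{l < \<bar>x\<bar>}\<close>, so by continuity from
    below one of them already has measure above \<open>s\<close>. This leaves a margin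
    \<open>1 / Suc n\<close> between \<open>l\<close> and the rearrangement.\<close>
  define E where "E n = {u \<in> {0..1}. l + 1 / real (Suc n) < \<bar>x u\<bar>}" for n
  have E[measurable]: "E n \<in> sets unit_leb" for n
  proof -
    have "{u \<in> space unit_leb. l + 1 / real (Suc n) < \<bar>x u\<bar>} \<in> sets unit_leb" by measurable
    then show ?thesis by (simp add: E_def)
  qed
  have "incseq E"
  proof (rule incseq_SucI)
    fix n
    have "1 / real (Suc (Suc n)) \<le> 1 / real (Suc n)" by (simp add: field_simps)
    then show "E n \<subseteq> E (Suc n)" by (auto simp: E_def)
  qed
  moreover have "(\<Union>n. E n) = {u \<in> {0..1}. l < \<bar>x u\<bar>}"
  proof (intro set_eqI iffI)
    fix u assume "u \<in> (\<Union>n. E n)"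
    then obtain n where "u \<in> {0..1}" "l + 1 / real (Suc n) < \<bar>x u\<bar>" by (auto simp: E_def)
    moreover have "0 < 1 / real (Suc n)" by simp
    ultimately have "u \<in> {0..1} \<and> l < \<bar>x u\<bar>" by linarith
    then show "u \<in> {u \<in> {0..1}. l < \<bar>x u\<bar>}" by blast
  next
    fix u assume u: "u \<in> {u \<in> {0..1}. l < \<bar>x u\<bar>}"
    then obtain n where "1 / real (Suc n) < \<bar>x u\<bar> - l"
      using nat_approx_posE[of "\<bar>x u\<bar> - l"] by auto
    with u have "u \<in> E n" by (auto simp: E_def)
    then show "u \<in> (\<Union>n. E n)" by blast
  qed
  ultimately have "(\<lambda>n. emeasure unit_leb (E n)) \<longlonglongrightarrow> emeasure unit_leb {u \<in> {0..1}. l < \<bar>x u\<bar>}"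
    using Lim_emeasure_incseq[of E unit_leb] E by (metis image_subsetI)
  then have "\<forall>\<^sub>F n in sequentially. ennreal s < emeasure unit_leb (E n)"
    using * by (rule order_tendstoD)
  then obtain n where n: "ennreal s < emeasure unit_leb (E n)"
    by (auto simp: eventually_sequentially)
  have "ennreal (l + 1 / real (Suc n)) \<le> decr_rearrangement x s"
    unfolding decr_rearrangement_def
  proof (rule INF_greatest)
    fix l' assume "l' \<in> {l. 0 < l \<and> emeasure lebesgue {u \<in> {0..1}. l < \<bar>x u\<bar>} \<le> ennreal s}"
    then have l': "emeasure unit_leb {u \<in> {0..1}. l' < \<bar>x u\<bar>} \<le> ennreal s"
      by (subst emeasure_unit_leb) auto
    show "ennreal (l + 1 / real (Suc n)) \<le> ennreal l'"
    proof (rule ccontr)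
      assume "\<not> ?thesis"
      then have "l' \<le> l + 1 / real (Suc n)"
        by (meson ennreal_leI linorder_linear)
      then have "E n \<subseteq> {u \<in> {0..1}. l' < \<bar>x u\<bar>}" by (auto simp: E_def)
      moreover have "{u \<in> space unit_leb. l' < \<bar>x u\<bar>} \<in> sets unit_leb" by measurable
      ultimately have "emeasure unit_leb (E n) \<le> emeasure unit_leb {u \<in> {0..1}. l' < \<bar>x u\<bar>}"
        by (intro emeasure_mono) auto
      with n l' show False by (meson leD order.strict_trans2 order_trans)
    qed
  qed
  moreover have "ennreal l < ennreal (l + 1 / real (Suc n))"
    using \<open>0 \<le> l\<close> by (simp add: ennreal_less_iff)
  ultimately show "ennreal l < decr_rearrangement x s" by (rule order.strict_trans2[rotated])
qed

text \<open>By the threshold criterion a superlevel set at a finite level has the form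
  \<open>{s. ennreal s < c}\<close> with constant \<open>c\<close>; the level infinity is never
  exceeded.\<close>

lemma borel_measurable_decr_rearrangement [measurable]:
  assumes "x \<in> borel_measurable unit_leb"
  shows "decr_rearrangement x \<in> borel_measurable lborel"
proof (rule borel_measurableI_greater)
  fix y :: ennreal
  show "{s \<in> space lborel. y < decr_rearrangement x s} \<in> sets lborel"
  proof (cases y)
    case (real r)
    then show ?thesis
      by (simp add: less_decr_rearrangement_iff[OF assms])
  qed simp
qed

text \<open>Let \<open>d\<close> be the measure of \<open>{l < \<bar>x\<bar>}\<close>. Within
  \<open>{0..t}\<close> the rearrangement exceeds \<open>l\<close> exactly at the points below
  \<open>d\<close>, hence on a set of length \<open>min t d\<close>; the layer cake formula
  integrates these lengths.\<close>

lemma nn_integral_decr_rearrangement: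
  assumes x: "x \<in> borel_measurable unit_leb" and "0 \<le> t"
  shows "(\<integral>\<^sup>+ s \<in> {0..t}. decr_rearrangement x s \<partial>lborel) =
    (\<integral>\<^sup>+ l. min (ennreal t) (emeasure unit_leb {u \<in> {0..1}. l < \<bar>x u\<bar>}) * indicator {0..} l \<partial>lborel)"
proof -
  have "(\<integral>\<^sup>+ s \<in> {0..t}. decr_rearrangement x s \<partial>lborel) =
    (\<integral>\<^sup>+ l. emeasure lborel {s \<in> space lborel. ennreal l < decr_rearrangement x s * indicator {0..t} s}
        * indicator {0..} l \<partial>lborel)"
    using borel_measurable_decr_rearrangement[OF x]
    by (intro nn_integral_layer_cake lborel.sigma_finite_measure_axioms borel_measurable_times_ennreal
        borel_measurable_indicator) auto
  also have "\<dots> = (\<integral>\<^sup>+ l. min (ennreal t) (emeasure unit_leb {u \<in> {0..1}. l < \<bar>x u\<bar>})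
      * indicator {0..} l \<partial>lborel)"
  proof (rule nn_integral_cong)
    fix l :: real
    show "emeasure lborel {s \<in> space lborel. ennreal l < decr_rearrangement x s * indicator {0..t} s}
        * indicator {0..} l =
        min (ennreal t) (emeasure unit_leb {u \<in> {0..1}. l < \<bar>x u\<bar>}) * indicator {0..} l"
    proof (cases "0 \<le> l")
      case True
      define d where "d = measure unit_leb {u \<in> {0..1}. l < \<bar>x u\<bar>}"
      have d: "emeasure unit_leb {u \<in> {0..1}. l < \<bar>x u\<bar>} = ennreal d" "0 \<le> d"
        by (simp_all add: d_def unit_leb.emeasure_eq_measure)
      have "{s \<in> space lborel. ennreal l < decr_rearrangement x s * indicator {0..t} s} =
          {s \<in> {0..t}. s < d}"
        using True d less_decr_rearrangement_iff[OF x True]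
        by (auto simp: ennreal_less_iff split: split_indicator)
      also have "emeasure lborel \<dots> = ennreal (min t d)"
      proof (cases "t < d")
        case True
        then have "{s \<in> {0..t}. s < d} = {0..t}" by auto
        then show ?thesis using True \<open>0 \<le> t\<close> by simp
      next
        case False
        then have "{s \<in> {0..t}. s < d} = {0..<d}" by auto
        then show ?thesis using False d by simp
      qed
      finally show ?thesis using True d \<open>0 \<le> t\<close> by (simp add: min_def)
    qed simp
  qed
  finally show ?thesis .
qed

text \<open>One half of the Hardy-Littlewood description: at each level, \<open>A\<close> meets
  \<open>{l < \<bar>x\<bar>}\<close> in measure at most the smaller of the two measures.\<close>

lemma set_nn_integral_le_decr_rearrangement:
  assumes x: "x \<in> borel_measurable unit_leb" and A: "A \<in> sets unit_leb"
  shows "(\<integral>\<^sup>+ u\<in>A. ennreal \<bar>x u\<bar> \<partial>unit_leb) \<le>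
    (\<integral>\<^sup>+ s \<in> {0..measure unit_leb A}. decr_rearrangement x s \<partial>lborel)"
proof -
  have "{u \<in> {0..1}. l < \<bar>x u\<bar>} \<in> sets unit_leb" for l
  proof -
    note x[measurable]
    have "{u \<in> space unit_leb. l < \<bar>x u\<bar>} \<in> sets unit_leb" by measurable
    then show ?thesis by simp
  qed
  then show ?thesis
    unfolding set_nn_integral_layer_cake[OF x A]
      nn_integral_decr_rearrangement[OF x measure_nonneg] unit_leb.emeasure_eq_measure[symmetric]
    using A by (intro nn_integral_mono mult_right_mono min.boundedI emeasure_mono) auto
qed

text \<open>The other half, by an extremal set. A set of measure \<open>t\<close> squeezed between
  \<open>{l0 < \<bar>x\<bar>}\<close> and \<open>{l0 \<le> \<bar>x\<bar>}\<close>, for the quantile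
  \<open>l0\<close>, is comparable by inclusion with every superlevel set, so nothing is lost at any
  level.\<close>

lemma exists_set_decr_rearrangement:
  assumes x[measurable]: "x \<in> borel_measurable unit_leb" and t: "0 < t" "t \<le> 1"
  shows "\<exists>A\<in>sets unit_leb. measure unit_leb A = t \<and>
    (\<integral>\<^sup>+ s \<in> {0..t}. decr_rearrangement x s \<partial>lborel) \<le> (\<integral>\<^sup>+ u\<in>A. ennreal \<bar>x u\<bar> \<partial>unit_leb)"
proof -
  let ?E = "\<lambda>l. {u \<in> {0..1}. l < \<bar>x u\<bar>}"
  define d where "d l = measure unit_leb (?E l)" for l
  have Es: "?E l \<in> sets unit_leb" for l
  proof -
    have "{u \<in> space unit_leb. l < \<bar>x u\<bar>} \<in> sets unit_leb" by measurable
    then show ?thesis by simp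
  qed
  have d_anti: "d l' \<le> d l" if "l \<le> l'" for l l'
    unfolding d_def using that Es by (intro unit_leb.finite_measure_mono) auto
  define L where "L = {l. 0 \<le> l \<and> d l \<le> t}"
  define l0 where "l0 = Inf L"
  \<comment> \<open>Since \<open>x\<close> has real values, its superlevel sets shrink to the empty
    set; together with \<open>0 < t\<close> this makes \<open>L\<close> nonempty.\<close>
  have lim: "(\<lambda>n. d (real n)) \<longlonglongrightarrow> 0"
  proof -
    have "decseq (\<lambda>n. ?E (real n))" by (rule decseq_SucI) auto
    then have "(\<lambda>n. measure unit_leb (?E (real n))) \<longlonglongrightarrow> measure unit_leb (\<Inter>n. ?E (real n))"
      using Es by (intro unit_leb.finite_Lim_measure_decseq) auto
    moreover have "(\<Inter>n. ?E (real n)) = {}"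
    proof -
      have "u \<notin> (\<Inter>n. ?E (real n))" for u
      proof -
        obtain n where "\<bar>x u\<bar> \<le> real n" using real_arch_simple by blast
        then have "u \<notin> ?E (real n)" by simp
        then show ?thesis by blast
      qed
      then show ?thesis by blast
    qed
    ultimately show ?thesis by (simp add: d_def)
  qed
  obtain n where "d (real n) < t"
    using order_tendstoD(2)[OF lim \<open>0 < t\<close>] by (auto simp: eventually_sequentially)
  then have Lne: "real n \<in> L" by (auto simp: L_def)
  have Lbd: "bdd_below L" by (auto simp: L_def bdd_below_def)
  have l0: "0 \<le> l0" unfolding l0_def by (rule cInf_greatest) (use Lne in \<open>auto simp: L_def intro!: exI[of _ "real n"]\<close>)
  have above: "d l \<le> t" if l: "l0 < l" for l
  proof -
    obtain l' where "l' \<in> L" "l' < l"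
      using l Lne cInf_lessD[of L l] unfolding l0_def by blast
    then show ?thesis using d_anti[of l' l] by (auto simp: L_def)
  qed
  have below: "t < d l" if "0 \<le> l" "l < l0" for l
    using that Lbd cInf_lower[of l L] by (force simp: L_def l0_def)
  \<comment> \<open>Continuity from below along \<open>l0 + 1 / Suc n\<close> shows that the infimum
    \<open>l0\<close> itself belongs to \<open>L\<close>.\<close>
  have E0: "d l0 \<le> t"
  proof -
    have "incseq (\<lambda>n. ?E (l0 + 1 / real (Suc n)))"
    proof (rule incseq_SucI)
      fix n
      have "1 / real (Suc (Suc n)) \<le> 1 / real (Suc n)" by (simp add: field_simps)
      then show "?E (l0 + 1 / real (Suc n)) \<subseteq> ?E (l0 + 1 / real (Suc (Suc n)))" by auto
    qed
    then have "(\<lambda>n. measure unit_leb (?E (l0 + 1 / real (Suc n)))) \<longlonglongrightarrow>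
        measure unit_leb (\<Union>n. ?E (l0 + 1 / real (Suc n)))"
      using Es by (intro unit_leb.finite_Lim_measure_incseq) auto
    moreover have "(\<Union>n. ?E (l0 + 1 / real (Suc n))) = ?E l0"
    proof (intro set_eqI iffI)
      fix u assume "u \<in> (\<Union>n. ?E (l0 + 1 / real (Suc n)))"
      then obtain n where "u \<in> {0..1}" "l0 + 1 / real (Suc n) < \<bar>x u\<bar>" by auto
      moreover have "0 < 1 / real (Suc n)" by simp
      ultimately have "u \<in> {0..1} \<and> l0 < \<bar>x u\<bar>" by linarith
      then show "u \<in> ?E l0" by blast
    next
      fix u assume u: "u \<in> ?E l0"
      then obtain n where "1 / real (Suc n) < \<bar>x u\<bar> - l0"
        using nat_approx_posE[of "\<bar>x u\<bar> - l0"] by auto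
      with u have "u \<in> ?E (l0 + 1 / real (Suc n))" by auto
      then show "u \<in> (\<Union>n. ?E (l0 + 1 / real (Suc n)))" by blast
    qed
    ultimately have "(\<lambda>n. d (l0 + 1 / real (Suc n))) \<longlonglongrightarrow> d l0" by (simp add: d_def)
    then show ?thesis by (rule LIMSEQ_le_const2) (auto intro!: above)
  qed
  let ?F = "{u \<in> {0..1}. l0 \<le> \<bar>x u\<bar>}"
  have Fs: "?F \<in> sets unit_leb"
  proof -
    have "{u \<in> space unit_leb. l0 \<le> \<bar>x u\<bar>} \<in> sets unit_leb" by measurable
    then show ?thesis by simp
  qed
  have F0: "t \<le> measure unit_leb ?F"
  proof (cases "l0 = 0")
    case True
    then have "?F = space unit_leb" by auto
    then show ?thesis using t unit_leb.prob_space by metis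
  next
    case False
    with l0 have pos: "0 < l0" by simp
    \<comment> \<open>These levels start at \<open>0\<close> and increase to \<open>l0\<close> while
      staying below it. Each of their strict superlevel sets therefore has measure above
      \<open>t\<close>, and the intersection of these sets is
      \<open>{l0 \<le> \<bar>x\<bar>}\<close>.\<close>
    let ?l = "\<lambda>n. l0 * (1 - 1 / real (Suc n))"
    have "decseq (\<lambda>n. ?E (?l n))"
    proof (rule decseq_SucI)
      fix n
      have "1 / real (Suc (Suc n)) \<le> 1 / real (Suc n)" by (simp add: field_simps)
      then have "?l n \<le> ?l (Suc n)" using pos by (intro mult_left_mono) auto
      then show "?E (?l (Suc n)) \<subseteq> ?E (?l n)" by auto
    qed
    then have "(\<lambda>n. measure unit_leb (?E (?l n))) \<longlonglongrightarrow> measure unit_leb (\<Inter>n. ?E (?l n))"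
      using Es by (intro unit_leb.finite_Lim_measure_decseq) auto
    moreover have "(\<Inter>n. ?E (?l n)) = ?F"
    proof (intro set_eqI iffI)
      fix u assume u: "u \<in> (\<Inter>n. ?E (?l n))"
      have "?l \<longlonglongrightarrow> l0 * (1 - 0)"
        by (intro tendsto_intros LIMSEQ_Suc[OF lim_1_over_n])
      then have "l0 * (1 - 0) \<le> \<bar>x u\<bar>"
        by (rule LIMSEQ_le_const2) (use u in \<open>auto intro: less_imp_le\<close>)
      then show "u \<in> ?F" using u by auto
    next
      fix u assume u: "u \<in> ?F"
      have "?l n < l0" for n using pos by (simp add: field_simps)
      with u show "u \<in> (\<Inter>n. ?E (?l n))" by (auto intro: less_le_trans)
    qed
    ultimately have "(\<lambda>n. d (?l n)) \<longlonglongrightarrow> measure unit_leb ?F" by (simp add: d_def)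
    moreover have "t \<le> d (?l n)" for n
    proof (rule less_imp_le[OF below])
      have "1 / real (Suc n) \<le> 1" by simp
      then show "0 \<le> ?l n" using pos by (intro mult_nonneg_nonneg) auto
      show "?l n < l0" using pos by (simp add: field_simps)
    qed
    ultimately show ?thesis by (intro LIMSEQ_le_const) auto
  qed
  obtain A where A: "A \<in> sets unit_leb" "?E l0 \<subseteq> A" "A \<subseteq> ?F" "measure unit_leb A = t"
    using exists_intermediate_measure[OF Es Fs _ E0[unfolded d_def] F0] by force
  have "min (ennreal t) (emeasure unit_leb (?E l)) \<le> emeasure unit_leb (A \<inter> ?E l)" if "0 \<le> l" for l
  proof (cases "l0 \<le> l")
    case True
    then have "?E l \<subseteq> ?E l0" by auto
    then have "A \<inter> ?E l = ?E l" using A(2) by blast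
    then show ?thesis by simp
  next
    case False
    then have "A \<inter> ?E l = A" using A(3) by auto
    then show ?thesis using A(4) by (metis min.cobounded1 unit_leb.emeasure_eq_measure)
  qed
  then have "(\<integral>\<^sup>+ s \<in> {0..t}. decr_rearrangement x s \<partial>lborel) \<le> (\<integral>\<^sup>+ u\<in>A. ennreal \<bar>x u\<bar> \<partial>unit_leb)"
    unfolding nn_integral_decr_rearrangement[OF x less_imp_le[OF t(1)]]
      set_nn_integral_layer_cake[OF x A(1)]
    by (intro nn_integral_mono) (simp split: split_indicator)
  with A show ?thesis by blast
qed

section \<open>The Marcinkiewicz norm through integrals over sets\<close>

lemma set_nn_integral_scaled_indicator:
  assumes "A \<in> sets unit_leb" "B \<in> sets unit_leb" "0 \<le> c"
  shows "(\<integral>\<^sup>+ u\<in>B. ennreal \<bar>c * indicator A u\<bar> \<partial>unit_leb) = ennreal (c * measure unit_leb (A \<inter> B))"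
proof -
  have "(\<integral>\<^sup>+ u\<in>B. ennreal \<bar>c * indicator A u\<bar> \<partial>unit_leb) =
      (\<integral>\<^sup>+ u. ennreal c * indicator (A \<inter> B) u \<partial>unit_leb)"
    using assms by (intro nn_integral_cong) (auto split: split_indicator)
  also have "\<dots> = ennreal c * emeasure unit_leb (A \<inter> B)"
    using assms by (intro nn_integral_cmult_indicator) auto
  finally show ?thesis
    using assms by (simp add: unit_leb.emeasure_eq_measure ennreal_mult)
qed

section \<open>The function \<open>tilde \<phi>\<close> and the Marcinkiewicz norm\<close>

locale marcinkiewicz_function =
  fixes \<phi> :: "real \<Rightarrow> real"
  assumes mono_phi: "mono_on {0..1} \<phi>" and concave_phi: "concave_on {0..1} \<phi>"
    and phi_0: "\<phi> 0 = 0" and phi_pos: "\<forall>t\<in>{0<..1}. 0 < \<phi> t"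
begin

lemma phi_le: "0 \<le> s \<Longrightarrow> s \<le> t \<Longrightarrow> t \<le> 1 \<Longrightarrow> \<phi> s \<le> \<phi> t"
  using mono_phi by (auto simp: mono_on_def)

lemma phi_gt_0: "0 < t \<Longrightarrow> t \<le> 1 \<Longrightarrow> 0 < \<phi> t"
  using phi_pos by simp

lemma tilde_0 [simp]: "tilde \<phi> 0 = 0"
  by (simp add: tilde_def)

lemma tilde_gt_0: "0 < t \<Longrightarrow> t \<le> 1 \<Longrightarrow> 0 < tilde \<phi> t"
  using phi_gt_0 by (simp add: tilde_def)

lemma tilde_nonneg: "0 \<le> t \<Longrightarrow> t \<le> 1 \<Longrightarrow> 0 \<le> tilde \<phi> t"
  using tilde_gt_0[of t] by (cases "t = 0") auto

text \<open>Concavity on \<open>{0..t}\<close> with \<open>\<phi> 0 = 0\<close> gives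
  \<open>s / t * \<phi> t \<le> \<phi> s\<close>: chords from the origin have nonincreasing
  slope.\<close>

lemma tilde_mono:
  assumes "0 \<le> s" "s \<le> t" "t \<le> 1"
  shows "tilde \<phi> s \<le> tilde \<phi> t"
proof (cases "s = 0")
  case True
  then show ?thesis using assms tilde_nonneg by simp
next
  case False
  with assms have s: "0 < s" "0 < t" by auto
  have "s / t * \<phi> t + (1 - s / t) * \<phi> 0 \<le> \<phi> (s / t * t + (1 - s / t) * 0)"
    using concave_onD[OF concave_phi, of "1 - s / t" t 0] assms s by (simp add: field_simps)
  then have "s / t * \<phi> t \<le> \<phi> s" using s phi_0 by simp
  then show ?thesis
    using phi_gt_0[of s] phi_gt_0[of t] assms s by (simp add: tilde_def field_simps)
qed

text \<open>Dividing each \<open>f n\<close> by the smaller \<open>\<phi> (f n)\<close> instead of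
  \<open>\<phi>\<close> of the total enlarges every summand. The sum on the right is extended
  because it may diverge.\<close>

lemma tilde_suminf_le:
  assumes f: "\<And>n. 0 \<le> f n" "summable f" and le: "(\<Sum>n. f n) \<le> 1"
  shows "ennreal (tilde \<phi> (\<Sum>n. f n)) \<le> (\<Sum>n. ennreal (tilde \<phi> (f n)))"
proof -
  let ?s = "\<Sum>n. f n"
  have s0: "0 \<le> ?s" using f by (simp add: suminf_nonneg)
  show ?thesis
  proof (cases "?s = 0")
    case False
    with s0 have s: "0 < ?s" by simp
    have fs: "f n \<le> ?s" for n
      using f sum_le_suminf[of f "{n}"] by simp
    have "tilde \<phi> ?s = (\<Sum>n. f n / \<phi> ?s)"
      using f(2) by (simp add: tilde_def suminf_divide)
    also have "ennreal \<dots> = (\<Sum>n. ennreal (f n / \<phi> ?s))"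
      using f phi_gt_0[OF s le] by (intro suminf_ennreal2[symmetric]) (auto intro: summable_divide)
    also have "\<dots> \<le> (\<Sum>n. ennreal (tilde \<phi> (f n)))"
    proof (intro suminf_le ennreal_leI)
      fix n
      show "f n / \<phi> ?s \<le> tilde \<phi> (f n)"
      proof (cases "f n = 0")
        case False
        with f have "0 < f n" by (simp add: less_le)
        then show ?thesis unfolding tilde_def
          using fs[of n] le phi_le[of "f n" ?s] phi_gt_0[of "f n"] by (intro divide_left_mono) auto
      qed simp
    qed auto
    finally show ?thesis .
  qed simp
qed

text \<open>The same comparison for two terms, in real numbers; it later absorbs a perturbation of a
  sequence.\<close>

lemma tilde_add_le:
  assumes "0 \<le> s" "0 \<le> t" "s + t \<le> 1"
  shows "tilde \<phi> (s + t) \<le> tilde \<phi> s + tilde \<phi> t"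
proof (cases "s = 0 \<or> t = 0")
  case False
  with assms have pos: "0 < s" "0 < t" by auto
  have "s / \<phi> (s + t) \<le> s / \<phi> s" "t / \<phi> (s + t) \<le> t / \<phi> t"
    using assms pos phi_le[of s "s + t"] phi_le[of t "s + t"] phi_gt_0[of s] phi_gt_0[of t]
    by (auto intro!: divide_left_mono mult_pos_pos phi_gt_0)
  then show ?thesis by (simp add: tilde_def add_divide_distrib)
qed auto

text \<open>With \<open>t\<close> the measure of \<open>A\<close>, the identity
  \<open>\<phi> t * tilde \<phi> t = t\<close> turns the integral of the rearrangement over
  \<open>{0..t}\<close> into the quantity under the supremum times \<open>tilde \<phi> t\<close>.
  Null sets are treated apart, since the supremum omits \<open>t = 0\<close>.\<close>

lemma set_nn_integral_le_norm:
  assumes x: "x \<in> borel_measurable unit_leb" and A: "A \<in> sets unit_leb"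
  shows "(\<integral>\<^sup>+ u\<in>A. ennreal \<bar>x u\<bar> \<partial>unit_leb) \<le>
    marcinkiewicz_norm \<phi> x * ennreal (tilde \<phi> (measure unit_leb A))"
proof (cases "measure unit_leb A = 0")
  case True
  then have "emeasure unit_leb A = 0" by (simp add: unit_leb.emeasure_eq_measure)
  then have "A \<in> null_sets unit_leb" using A by auto
  then show ?thesis by (simp add: nn_integral_null_set)
next
  case False
  let ?t = "measure unit_leb A"
  have t: "0 < ?t" "?t \<le> 1" using False by (simp_all add: zero_less_measure_iff)
  let ?I = "\<integral>\<^sup>+ s \<in> {0..?t}. decr_rearrangement x s \<partial>lborel"
  \<comment> \<open>The integral may be infinite, so only the finite positive factors are
    cancelled.\<close>
  have "?I = ennreal (\<phi> ?t) * (?I / ennreal ?t) * ennreal (tilde \<phi> ?t)"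
  proof -
    have "?I = ?I * ennreal (\<phi> ?t * (1 / ?t) * tilde \<phi> ?t)"
      using t phi_gt_0[OF t] by (simp add: tilde_def)
    also have "\<dots> = ?I * (ennreal (\<phi> ?t) * ennreal (1 / ?t) * ennreal (tilde \<phi> ?t))"
      using t phi_gt_0[OF t] tilde_gt_0[OF t]
      by (simp add: ennreal_mult[symmetric] mult_nonneg_nonneg less_imp_le del: times_divide_eq_right)
    also have "ennreal (1 / ?t) = inverse (ennreal ?t)"
      using t by (simp add: inverse_ennreal inverse_eq_divide)
    also have "?I * (ennreal (\<phi> ?t) * inverse (ennreal ?t) * ennreal (tilde \<phi> ?t)) =
        ennreal (\<phi> ?t) * (?I / ennreal ?t) * ennreal (tilde \<phi> ?t)"
      by (simp add: divide_ennreal_def ac_simps)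
    finally show ?thesis .
  qed
  also have "\<dots> \<le> marcinkiewicz_norm \<phi> x * ennreal (tilde \<phi> ?t)"
    unfolding marcinkiewicz_norm_def max_rearrangement_def[symmetric]
    by (intro mult_right_mono SUP_upper) (use t in auto)
  finally show ?thesis
    using set_nn_integral_le_decr_rearrangement[OF x A] by order
qed

text \<open>For each \<open>t\<close> the hypothesis is applied to the extremal set of measure
  \<open>t\<close>. Together with the preceding bound this describes the norm by integrals over
  sets, and decreasing rearrangements of functions no longer appear.\<close>

lemma norm_le:
  assumes x: "x \<in> borel_measurable unit_leb"
    and le: "\<And>A. A \<in> sets unit_leb \<Longrightarrow>
      (\<integral>\<^sup>+ u\<in>A. ennreal \<bar>x u\<bar> \<partial>unit_leb) \<le> K * ennreal (tilde \<phi> (measure unit_leb A))"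
  shows "marcinkiewicz_norm \<phi> x \<le> K"
  unfolding marcinkiewicz_norm_def
proof (rule SUP_least)
  fix t :: real assume "t \<in> {0<..1}"
  then have t: "0 < t" "t \<le> 1" by auto
  let ?I = "\<integral>\<^sup>+ s \<in> {0..t}. decr_rearrangement x s \<partial>lborel"
  obtain A where A: "A \<in> sets unit_leb" "measure unit_leb A = t"
    "?I \<le> (\<integral>\<^sup>+ u\<in>A. ennreal \<bar>x u\<bar> \<partial>unit_leb)"
    using exists_set_decr_rearrangement[OF x t] by blast
  with le[OF A(1)] have I: "?I \<le> K * ennreal (tilde \<phi> t)" by simp
  have "ennreal (\<phi> t) * max_rearrangement x t \<le>
      ennreal (\<phi> t) * (K * ennreal (tilde \<phi> t) * inverse (ennreal t))"
    unfolding max_rearrangement_def divide_ennreal_def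
    by (intro mult_left_mono mult_right_mono I) auto
  also have "inverse (ennreal t) = ennreal (1 / t)"
    using t by (simp add: inverse_ennreal inverse_eq_divide)
  also have "ennreal (\<phi> t) * (K * ennreal (tilde \<phi> t) * ennreal (1 / t)) =
      K * (ennreal (\<phi> t) * ennreal (tilde \<phi> t) * ennreal (1 / t))"
    by (simp add: ac_simps)
  also have "ennreal (\<phi> t) * ennreal (tilde \<phi> t) * ennreal (1 / t) =
      ennreal (\<phi> t * tilde \<phi> t * (1 / t))"
    using t phi_gt_0[OF t] tilde_gt_0[OF t]
      by (simp add: ennreal_mult[symmetric] mult_nonneg_nonneg less_imp_le del: times_divide_eq_right)
  also have "\<phi> t * tilde \<phi> t * (1 / t) = 1"
    using t phi_gt_0[OF t] by (simp add: tilde_def)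
  finally show "ennreal (\<phi> t) * max_rearrangement x t \<le> K" by simp
qed

lemma norm_mono_AE:
  assumes x: "x \<in> borel_measurable unit_leb" and y: "y \<in> borel_measurable unit_leb"
    and le: "AE u in unit_leb. \<bar>x u\<bar> \<le> \<bar>y u\<bar>"
  shows "marcinkiewicz_norm \<phi> x \<le> marcinkiewicz_norm \<phi> y"
proof (rule norm_le[OF x])
  fix A assume A: "A \<in> sets unit_leb"
  have "(\<integral>\<^sup>+ u\<in>A. ennreal \<bar>x u\<bar> \<partial>unit_leb) \<le> (\<integral>\<^sup>+ u\<in>A. ennreal \<bar>y u\<bar> \<partial>unit_leb)"
    by (rule nn_integral_mono_AE) (use le in \<open>auto intro!: mult_right_mono ennreal_leI\<close>)
  also note set_nn_integral_le_norm[OF y A]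
  finally show "(\<integral>\<^sup>+ u\<in>A. ennreal \<bar>x u\<bar> \<partial>unit_leb) \<le>
    marcinkiewicz_norm \<phi> y * ennreal (tilde \<phi> (measure unit_leb A))" .
qed

text \<open>Read with \<open>a\<close>, \<open>b\<close> the measures of \<open>A\<close>,
  \<open>B\<close> and \<open>m\<close> that of \<open>A \<inter> B\<close>: it bounds the integral
  over \<open>B\<close> of the normalized indicator of \<open>A\<close>. For
  \<open>a \<le> b\<close> monotonicity of \<open>tilde \<phi>\<close> is used, otherwise that of
  \<open>\<phi>\<close>.\<close>

lemma min_div_phi_le_tilde:
  assumes "0 < a" "a \<le> 1" "0 \<le> b" "b \<le> 1" "m \<le> a" "m \<le> b"
  shows "m / \<phi> a \<le> tilde \<phi> b"
proof (cases "a \<le> b")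
  case True
  have "m / \<phi> a \<le> tilde \<phi> a"
    using assms phi_gt_0[of a] by (simp add: tilde_def divide_right_mono)
  also have "\<dots> \<le> tilde \<phi> b" using True assms by (intro tilde_mono) auto
  finally show ?thesis .
next
  case False
  show ?thesis
  proof (cases "b = 0")
    case True
    then show ?thesis using assms phi_gt_0[of a] by (simp add: divide_nonpos_pos)
  next
    case b: False
    have "m / \<phi> a \<le> b / \<phi> a"
      using assms phi_gt_0[of a] by (simp add: divide_right_mono)
    also have "\<dots> \<le> tilde \<phi> b" unfolding tilde_def
      using assms False b phi_le[of b a] phi_gt_0[of a] phi_gt_0[of b]
      by (intro divide_left_mono) auto
    finally show ?thesis .
  qed
qed

text \<open>Testing on \<open>A\<close> itself gives the lower bound, and intersecting
  \<open>A\<close> with an arbitrary \<open>B\<close> the upper one. In other words,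
  \<open>\<phi>\<close> is the fundamental function of the space.\<close>

lemma norm_normalized_indicator:
  assumes A: "A \<in> sets unit_leb" and pos: "0 < measure unit_leb A"
  shows "marcinkiewicz_norm \<phi> (\<lambda>u. 1 / \<phi> (measure unit_leb A) * indicator A u) = 1"
proof -
  let ?a = "measure unit_leb A"
  let ?x = "\<lambda>u. 1 / \<phi> ?a * indicator A u"
  have a: "0 < ?a" "?a \<le> 1" using pos by simp_all
  have x: "?x \<in> borel_measurable unit_leb" using A by measurable
  have c: "0 \<le> 1 / \<phi> ?a" using phi_gt_0[OF a] by simp
  show ?thesis
  proof (rule antisym)
    show "marcinkiewicz_norm \<phi> ?x \<le> 1"
    proof (rule norm_le[OF x])
      fix B assume B: "B \<in> sets unit_leb"
      have "measure unit_leb (A \<inter> B) / \<phi> ?a \<le> tilde \<phi> (measure unit_leb B)"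
        using A B a by (intro min_div_phi_le_tilde unit_leb.finite_measure_mono) auto
      then show "(\<integral>\<^sup>+ u\<in>B. ennreal \<bar>?x u\<bar> \<partial>unit_leb) \<le> 1 * ennreal (tilde \<phi> (measure unit_leb B))"
        unfolding set_nn_integral_scaled_indicator[OF A B c] by (simp add: ennreal_leI)
    qed
    have "(\<integral>\<^sup>+ u\<in>A. ennreal \<bar>?x u\<bar> \<partial>unit_leb) \<le> marcinkiewicz_norm \<phi> ?x * ennreal (tilde \<phi> ?a)"
      by (rule set_nn_integral_le_norm[OF x A])
    then have *: "ennreal (tilde \<phi> ?a) \<le> marcinkiewicz_norm \<phi> ?x * ennreal (tilde \<phi> ?a)"
      unfolding set_nn_integral_scaled_indicator[OF A A c] by (simp add: tilde_def)
    show "1 \<le> marcinkiewicz_norm \<phi> ?x"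
    proof (cases "marcinkiewicz_norm \<phi> ?x")
      case (real r)
      then show ?thesis using * tilde_gt_0[OF a]
        by (simp add: ennreal_mult[symmetric] ennreal_le_iff)
    qed simp
  qed
qed

text \<open>If no dilation were a contraction, the quotient defining the index would be constantly
  \<open>1\<close>.\<close>

lemma exists_tilde_contraction:
  assumes "upper_dilation_index \<phi> < 1"
  shows "\<exists>T q. 1 < T \<and> 0 < q \<and> q < 1 \<and>
    (\<forall>s. 0 < s \<longrightarrow> s * T \<le> 1 \<longrightarrow> tilde \<phi> s \<le> q * tilde \<phi> (s * T))"
proof -
  let ?D = "\<lambda>t. {\<phi> (s * t) / \<phi> s | s. s \<in> {0<..1} \<and> s * t \<in> {0<..1}}"
  \<comment> \<open>Monotonicity of \<open>tilde \<phi>\<close> bounds every quotient by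
    \<open>t\<close>, so for \<open>t > 1\<close> the supremum defining the dilation function is
    finite and at most \<open>t\<close>.\<close>
  have le: "v \<le> t" if v: "v \<in> ?D t" "1 < t" for v t
  proof -
    obtain s where s: "v = \<phi> (s * t) / \<phi> s" "0 < s" "s * t \<le> 1" "0 < s * t" "s \<le> 1"
      using v by auto
    then have "tilde \<phi> s \<le> tilde \<phi> (s * t)" using that by (intro tilde_mono) auto
    then have "\<phi> (s * t) \<le> t * \<phi> s"
      using s phi_gt_0[of s] phi_gt_0[of "s * t"] by (simp add: tilde_def field_simps)
    then show ?thesis unfolding s(1) using s phi_gt_0[of s] by (simp add: divide_le_eq)
  qed
  have ne: "?D t \<noteq> {}" if "1 < t" for t
  proof -
    have "\<phi> (1 / t * t) / \<phi> (1 / t) \<in> ?D t" using that by (intro CollectI exI[of _ "1 / t"]) auto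
    then show ?thesis by blast
  qed
  have bdd: "bdd_above (?D t)" if "1 < t" for t
    by (rule bdd_aboveI) (rule le[OF _ that])
  have dil_le: "dilation_function \<phi> t \<le> t" if "1 < t" for t
    unfolding dilation_function_def by (rule cSup_least[OF ne[OF that]]) (rule le[OF _ that])
  have "\<exists>T>1. dilation_function \<phi> T < T"
  proof (rule ccontr)
    assume "\<not> ?thesis"
    then have eq: "dilation_function \<phi> t = t" if "1 < t" for t
      using dil_le[OF that] that by force
    have "((\<lambda>t. ln (dilation_function \<phi> t) / ln t) \<longlongrightarrow> 1) at_top"
    proof (rule tendsto_eventually)
      show "\<forall>\<^sub>F t in at_top. ln (dilation_function \<phi> t) / ln t = 1"
        using eventually_gt_at_top[of 1] by eventually_elim (simp add: eq)
    qed
    then have "upper_dilation_index \<phi> = 1"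
      unfolding upper_dilation_index_def by (intro tendsto_Lim) auto
    then show False using assms by simp
  qed
  then obtain T where T: "1 < T" "dilation_function \<phi> T < T" by blast
  \<comment> \<open>The maximum with \<open>1 / 2\<close> gives \<open>0 < q\<close> at once and
    keeps \<open>q < 1\<close>.\<close>
  define q where "q = max (1 / 2) (dilation_function \<phi> T / T)"
  have "tilde \<phi> s \<le> q * tilde \<phi> (s * T)" if s: "0 < s" "s * T \<le> 1" for s
  proof -
    have "s * 1 \<le> s * T" using s T by (intro mult_left_mono) auto
    with s have "s \<le> 1" by linarith
    moreover have "0 < s * T" using s T by auto
    ultimately have s1: "s \<le> 1" "0 < s * T" .
    have "\<phi> (s * T) / \<phi> s \<le> dilation_function \<phi> T"
      unfolding dilation_function_def using s s1 by (intro cSup_upper bdd[OF T(1)]) auto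
    also have "\<dots> \<le> q * T"
    proof -
      have "dilation_function \<phi> T / T \<le> q" by (simp add: q_def)
      then show ?thesis using T(1) by (simp add: field_simps)
    qed
    finally have "\<phi> (s * T) \<le> q * T * \<phi> s"
      using s s1 phi_gt_0[of s] by (simp add: divide_le_eq)
    then have "s * \<phi> (s * T) \<le> s * (q * T * \<phi> s)"
      using s by (intro mult_left_mono) auto
    then show ?thesis
      using s s1 phi_gt_0[of s] phi_gt_0[of "s * T"] by (simp add: tilde_def divide_simps ac_simps)
  qed
  moreover have "0 < q" "q < 1" using T by (auto simp: q_def)
  ultimately show ?thesis using T(1) by blast
qed

end

section \<open>Level sets of the weight\<close>

text \<open>A greedy choice works: finiteness above each positive level yields a largest value among
  the indices not yet taken, and infinitely many positive values keep the choice going.\<close>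

lemma seq_rearrangement_enumeration:
  fixes a :: "'i \<Rightarrow> real"
  assumes fin: "\<And>e. 0 < e \<Longrightarrow> finite {k. e < a k}" and inf: "infinite {k. 0 < a k}"
  shows "\<exists>\<kappa>. inj \<kappa> \<and> range \<kappa> = {k. 0 < a k} \<and> (\<forall>r. seq_rearrangement a r = a (\<kappa> r))"
proof -
  have ex: "\<exists>k. k \<notin> S \<and> 0 < a k \<and> (\<forall>j. j \<notin> S \<longrightarrow> a j \<le> a k)" if S: "finite S" for S
  proof -
    have "infinite ({k. 0 < a k} - S)" using inf S by (rule Diff_infinite_finite[rotated])
    then obtain k0 where k0: "k0 \<notin> S" "0 < a k0"
      by (metis DiffE ex_in_conv finite.emptyI mem_Collect_eq)
    \<comment> \<open>Only finitely many values exceed half of the positive value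
      \<open>a k0\<close>, so a maximum over \<open>Q\<close> exists; it dominates all indices
      outside \<open>S\<close>.\<close>
    define Q where "Q = {k. a k0 / 2 < a k} - S"
    have Q: "finite Q" "k0 \<in> Q" using fin[of "a k0 / 2"] k0 by (auto simp: Q_def)
    then have "Max (a ` Q) \<in> a ` Q" by (intro Max_in) auto
    then obtain k where k: "k \<in> Q" "a k = Max (a ` Q)" by (metis imageE)
    have max: "a j \<le> a k" if "j \<in> Q" for j using k Q that by simp
    have "a j \<le> a k" if "j \<notin> S" for j
    proof (cases "j \<in> Q")
      case False
      then have "a j \<le> a k0 / 2" using that by (auto simp: Q_def)
      then show ?thesis using max[OF Q(2)] k0 by linarith
    qed (rule max)
    moreover have "k \<notin> S" "0 < a k" using k k0 max[OF Q(2)] by (auto simp: Q_def)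
    ultimately show ?thesis by blast
  qed
  define nx where "nx S = (SOME k. k \<notin> S \<and> 0 < a k \<and> (\<forall>j. j \<notin> S \<longrightarrow> a j \<le> a k))" for S
  have nx: "nx S \<notin> S" "0 < a (nx S)" "j \<notin> S \<Longrightarrow> a j \<le> a (nx S)" if "finite S" for S j
    using someI_ex[OF ex[OF that]] unfolding nx_def by blast+
  \<comment> \<open>\<open>P n\<close> is the set of the first \<open>n\<close> chosen indices, so
    \<open>\<kappa> n\<close> depends on its predecessors through this finite set.\<close>
  define P where "P = rec_nat {} (\<lambda>_ S. insert (nx S) S)"
  define \<kappa> where "\<kappa> n = nx (P n)" for n
  have "P 0 = {}" "P (Suc n) = insert (\<kappa> n) (P n)" for n
    by (simp_all add: P_def \<kappa>_def)
  then have P: "P n = \<kappa> ` {..<n}" for n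
    by (induction n) (simp_all add: lessThan_Suc)
  have finP: "finite (P n)" for n by (simp add: P)
  have fresh: "\<kappa> n \<notin> \<kappa> ` {..<n}" for n by (rule nx(1)[OF finP[of n], folded \<kappa>_def, unfolded P])
  have "inj \<kappa>"
  proof (rule injI)
    fix m n assume "\<kappa> m = \<kappa> n"
    then show "m = n" using fresh[of m] fresh[of n]
      by (metis imageI lessThan_iff linorder_neqE_nat)
  qed
  have pos: "0 < a (\<kappa> n)" for n by (rule nx(2)[OF finP[of n], folded \<kappa>_def])
  have large: "a j \<le> a (\<kappa> n)" if "j \<notin> \<kappa> ` {..<n}" for j n
    by (rule nx(3)[OF finP[of n], folded \<kappa>_def, unfolded P, OF that])
  have anti: "a (\<kappa> n) \<le> a (\<kappa> m)" if "m \<le> n" for m n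
    using \<open>inj \<kappa>\<close> that by (intro large) (auto dest: injD)
  have "range \<kappa> = {k. 0 < a k}"
  proof (intro equalityI subsetI)
    fix k assume k: "k \<in> {k. 0 < a k}"
    \<comment> \<open>The value at an index never chosen would be at most every chosen value, so
      infinitely many values would exceed half of it.\<close>
    show "k \<in> range \<kappa>"
    proof (rule ccontr)
      assume "k \<notin> range \<kappa>"
      then have "a k \<le> a (\<kappa> n)" for n by (intro large) auto
      moreover have "a k / 2 < a k" using k by simp
      ultimately have "a k / 2 < a (\<kappa> n)" for n by (rule less_le_trans[rotated])
      then have "range \<kappa> \<subseteq> {j. a k / 2 < a j}" by blast
      then have "finite (range \<kappa>)" using fin[of "a k / 2"] k finite_subset by auto
      then show False using \<open>inj \<kappa>\<close> finite_imageD infinite_UNIV_nat by blast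
    qed
  qed (use pos in auto)
  moreover have "seq_rearrangement a r = a (\<kappa> r)" for r
  proof -
    \<comment> \<open>If \<open>l\<close> is below \<open>a (\<kappa> r)\<close>, the indices
      \<open>\<kappa> 0\<close> to \<open>\<kappa> r\<close> already number \<open>r + 1\<close>;
      otherwise only the first \<open>r\<close> chosen indices can have values above
      \<open>l\<close>.\<close>
    have "finite {k. l < a k} \<and> card {k. l < a k} \<le> r \<longleftrightarrow> a (\<kappa> r) \<le> l" if "0 \<le> l" for l
    proof
      assume le: "a (\<kappa> r) \<le> l"
      have sub: "{k. l < a k} \<subseteq> \<kappa> ` {..<r}"
      proof
        fix k assume "k \<in> {k. l < a k}"
        with le have "\<not> a k \<le> a (\<kappa> r)" by simp
        then show "k \<in> \<kappa> ` {..<r}" using large by blast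
      qed
      have "card {k. l < a k} \<le> card (\<kappa> ` {..<r})" by (rule card_mono[OF _ sub]) simp
      also have "\<dots> \<le> r" using card_image_le[of "{..<r}" \<kappa>] by simp
      finally show "finite {k. l < a k} \<and> card {k. l < a k} \<le> r"
        using finite_subset[OF sub] by simp
    next
      assume f: "finite {k. l < a k} \<and> card {k. l < a k} \<le> r"
      show "a (\<kappa> r) \<le> l"
      proof (rule ccontr)
        assume "\<not> ?thesis"
        then have "l < a (\<kappa> n)" if "n \<le> r" for n using anti[OF that] by simp
        then have "\<kappa> ` {..r} \<subseteq> {k. l < a k}" by blast
        then have "card (\<kappa> ` {..r}) \<le> r" using f card_mono order_trans by blast
        moreover have "card (\<kappa> ` {..r}) = Suc r"
          using \<open>inj \<kappa>\<close> by (subst card_image) (auto intro: inj_on_subset)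
        ultimately show False by simp
      qed
    qed
    then have "{l. 0 \<le> l \<and> finite {k. l < a k} \<and> card {k. l < a k} \<le> r} =
        {l. 0 \<le> l \<and> a (\<kappa> r) \<le> l}"
      by blast
    also have "\<dots> = {a (\<kappa> r)..}" using pos[of r] by auto
    finally have "{l. 0 \<le> l \<and> finite {k. l < a k} \<and> card {k. l < a k} \<le> r} = {a (\<kappa> r)..}" .
    then show ?thesis by (simp add: seq_rearrangement_def)
  qed
  ultimately show ?thesis using \<open>inj \<kappa>\<close> by blast
qed

lemma level_set_sets [measurable]:
  assumes [measurable]: "w \<in> borel_measurable unit_leb"
  shows "level_set w k \<in> sets unit_leb"
proof -
  have "{t \<in> space unit_leb. w t \<in> {2 powi k ..< 2 powi (k + 1)}} \<in> sets unit_leb" by measurable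
  then show ?thesis by (simp add: level_set_def)
qed

lemma level_set_disjoint:
  assumes "k \<noteq> k'"
  shows "level_set w k \<inter> level_set w k' = {}"
proof -
  have "level_set w j \<inter> level_set w j' = {}" if "j < j'" for j j'
  proof -
    have "(2::real) powi (j + 1) \<le> 2 powi j'" using that by (intro power_int_increasing) auto
    then show ?thesis by (auto simp: level_set_def)
  qed
  then show ?thesis using assms by (metis Int_commute linorder_neqE)
qed

lemma exists_level:
  assumes "0 < w t" "t \<in> {0..1}"
  shows "\<exists>k. t \<in> level_set w k"
proof -
  define k where "k = \<lfloor>log 2 (w t)\<rfloor>"
  have k: "real_of_int k \<le> log 2 (w t)" "log 2 (w t) < real_of_int (k + 1)"
    unfolding k_def by linarith+
  have "2 powr real_of_int k \<le> w t" "w t < 2 powr real_of_int (k + 1)"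
    using k assms(1) by (simp_all add: le_log_iff log_less_iff)
  then have "t \<in> level_set w k"
    using assms(2) powr_real_of_int'[of 2 k] powr_real_of_int'[of 2 "k + 1"]
    by (simp add: level_set_def)
  then show ?thesis ..
qed

text \<open>The level sets are disjoint in a probability space, so only finitely many exceed a given
  positive measure. If only finitely many were non-null, \<open>w\<close> and \<open>1 / w\<close>
  would both be essentially bounded, against non-triviality. The map \<open>\<kappa>\<close> thus
  ties the terms of \<open>weight_seq\<close> to actual level sets.\<close>

lemma level_set_enumeration:
  assumes "nontrivial_weight w"
  shows "\<exists>\<kappa>. inj \<kappa> \<and> (\<forall>r. weight_seq w r = measure unit_leb (level_set w (\<kappa> r)))
    \<and> (\<forall>r. 0 < measure unit_leb (level_set w (\<kappa> r)))
    \<and> (AE t in unit_leb. \<exists>r. t \<in> level_set w (\<kappa> r))"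
proof -
  have w[measurable]: "w \<in> borel_measurable unit_leb" and wpos: "AE t in unit_leb. 0 < w t"
    using assms by (auto simp: nontrivial_weight_def weight_def)
  define a where "a k = measure unit_leb (level_set w k)" for k
  have a_leb: "measure lebesgue (level_set w k) = a k" for k
    unfolding a_def by (rule measure_unit_leb[symmetric]) (auto simp: level_set_def)
  have fin: "finite {k. e < a k}" if e: "0 < e" for e
  proof (rule ccontr)
    assume "infinite {k. e < a k}"
    obtain n :: nat where n: "1 / e < real n" using reals_Archimedean2 by blast
    obtain F where F: "finite F" "card F = n" "F \<subseteq> {k. e < a k}"
      using infinite_arbitrarily_large[OF \<open>infinite {k. e < a k}\<close>] by metis
    have "real n * e = (\<Sum>k\<in>F. e)" using F by simp
    also have "\<dots> \<le> (\<Sum>k\<in>F. a k)" using F by (intro sum_mono) auto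
    also have "\<dots> = measure unit_leb (\<Union>k\<in>F. level_set w k)"
      unfolding a_def using F
      by (intro unit_leb.finite_measure_finite_Union[symmetric])
        (auto simp: disjoint_family_on_def level_set_disjoint)
    also have "\<dots> \<le> 1" by simp
    finally show False using n e by (simp add: field_simps)
  qed
  have ae: "AE t in unit_leb. \<exists>k. t \<in> level_set w k \<and> 0 < a k"
  proof -
    have "AE t in unit_leb. \<forall>k. a k = 0 \<longrightarrow> t \<notin> level_set w k"
    proof (subst AE_all_countable, intro allI)
      fix k
      show "AE t in unit_leb. a k = 0 \<longrightarrow> t \<notin> level_set w k"
      proof (cases "a k = 0")
        case True
        then have "level_set w k \<in> null_sets unit_leb"
          by (auto simp: a_def unit_leb.emeasure_eq_measure)
        then show ?thesis by (auto dest: AE_not_in)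
      qed simp
    qed
    then show ?thesis using wpos AE_space
    proof eventually_elim
      case (elim t)
      then obtain k where "t \<in> level_set w k" using exists_level[of w t] by auto
      moreover have "0 \<le> a k" by (simp add: a_def)
      ultimately show ?case using elim by (metis less_eq_real_def)
    qed
  qed
  have inf: "infinite {k. 0 < a k}"
  proof
    assume f: "finite {k. 0 < a k}"
    obtain N where N: "\<And>k. 0 < a k \<Longrightarrow> \<bar>k\<bar> \<le> N"
    proof
      show "\<bar>k\<bar> \<le> Max (abs ` {k. 0 < a k})" if "0 < a k" for k
        using f that by (intro Max_ge) auto
    qed
    \<comment> \<open>All non-null levels lie between \<open>- N\<close> and \<open>N\<close>; the
      exponent \<open>N + 1\<close> is the upper end of the top level.\<close>
    have "AE t in unit_leb. w t \<le> 2 powi (N + 1) \<and> 1 / w t \<le> 2 powi N"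
      using ae
    proof eventually_elim
      case (elim t)
      then obtain k where k: "t \<in> level_set w k" "0 < a k" by blast
      then have wt: "2 powi k \<le> w t" "w t < 2 powi (k + 1)" by (auto simp: level_set_def)
      have "(2::real) powi (k + 1) \<le> 2 powi (N + 1)" "(2::real) powi (- N) \<le> 2 powi k"
        using N[OF k(2)] by (auto intro!: power_int_increasing)
      moreover from this have "2 powi (- N) \<le> w t" using wt by linarith
      then have "1 / w t \<le> 1 / 2 powi (- N)"
        by (intro divide_left_mono mult_pos_pos) (auto intro: less_le_trans[of _ "2 powi (- N)"])
      ultimately show ?case using wt by (auto simp: power_int_minus divide_inverse)
    qed
    then have "ess_bounded_above w" "ess_bounded_above (\<lambda>t. 1 / w t)"
      unfolding ess_bounded_above_def by (auto elim: AE_mp)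
    then show False using assms by (simp add: nontrivial_weight_def)
  qed
  obtain \<kappa> where \<kappa>: "inj \<kappa>" "range \<kappa> = {k. 0 < a k}" "\<And>r. seq_rearrangement a r = a (\<kappa> r)"
    using seq_rearrangement_enumeration[OF fin inf] by blast
  have "AE t in unit_leb. \<exists>r. t \<in> level_set w (\<kappa> r)"
    using ae
  proof eventually_elim
    case (elim t)
    then obtain k where "t \<in> level_set w k" "k \<in> range \<kappa>" using \<kappa>(2) by auto
    then show ?case by blast
  qed
  moreover have "0 < measure unit_leb (level_set w (\<kappa> r))" for r
    using \<kappa>(2) by (force simp: a_def)
  moreover have "weight_seq w r = measure unit_leb (level_set w (\<kappa> r))" for r
    by (simp add: weight_seq_def a_leb \<kappa>(3) flip: a_def)
  ultimately show ?thesis using \<kappa>(1) by blast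
qed

section \<open>Families separated by the weight\<close>

text \<open>Turns essential bounds into inequalities at an actual point of a non-null set.\<close>

lemma exists_point_AE:
  assumes B: "B \<in> sets unit_leb" "0 < measure unit_leb B" and P: "AE u in unit_leb. P u"
  shows "\<exists>u\<in>B. P u"
proof (rule ccontr)
  assume "\<not> ?thesis"
  then have "AE u in unit_leb. u \<notin> B" using P by (auto elim: AE_mp)
  then have "measure unit_leb B = 0" using unit_leb.prob_eq_0[OF B(1)] by simp
  then show False using B by simp
qed

lemma AE_lebesgue_on_subset:
  assumes S: "S \<in> sets unit_leb"
  shows "(AE u in lebesgue_on S. P u) \<longleftrightarrow> (AE u in unit_leb. u \<in> S \<longrightarrow> P u)"
proof -
  have "(AE u in lebesgue_on S. P u) \<longleftrightarrow> (AE u in lebesgue. u \<in> S \<longrightarrow> P u)"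
    using sets_unit_lebD[OF S] by (subst AE_restrict_space_iff) auto
  also have "\<dots> \<longleftrightarrow> (AE u in unit_leb. u \<in> S \<longrightarrow> P u)"
    using sets_unit_lebD(2)[OF S] by (subst AE_restrict_space_iff) (auto intro!: AE_cong)
  finally show ?thesis .
qed

lemma borel_measurable_lebesgue_on_subset:
  fixes w :: "real \<Rightarrow> real"
  assumes "w \<in> borel_measurable unit_leb" "S \<in> sets unit_leb"
  shows "w \<in> borel_measurable (lebesgue_on S)"
  using measurable_restrict_mono[OF assms(1) sets_unit_lebD(2)[OF assms(2)]] .

lemma le_ess_sup_on:
  assumes S: "S \<in> sets unit_leb"
  shows "AE u in unit_leb. u \<in> S \<longrightarrow> ereal (w u) \<le> ess_sup_on S w"
  unfolding ess_sup_on_def AE_lebesgue_on_subset[OF S, symmetric] by (rule esssup_AE)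

lemma ess_inf_on_le:
  assumes S: "S \<in> sets unit_leb"
  shows "AE u in unit_leb. u \<in> S \<longrightarrow> ess_inf_on S w \<le> ereal (w u)"
proof -
  have "AE u in lebesgue_on S. - ereal (w u) \<le> esssup (lebesgue_on S) (\<lambda>t. - ereal (w t))"
    by (rule esssup_AE)
  then show ?thesis
    unfolding AE_lebesgue_on_subset[OF S] ess_inf_on_def
    by (auto elim!: AE_mp simp: ereal_uminus_le_reorder)
qed

text \<open>\<open>S i\<close> stands for the union of the supports of \<open>x i\<close> and
  \<open>y i\<close> in the definition of decomposability. Positive measure supplies points through
  which the bounds pass from one neighbour to the next.\<close>

locale separated_family =
  fixes w :: "real \<Rightarrow> real" and n :: nat and S :: "nat \<Rightarrow> real set"
  assumes w: "w \<in> borel_measurable unit_leb" and w_pos: "AE t in unit_leb. 0 < w t"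
    and S: "\<And>i. i \<in> {1..n} \<Longrightarrow> S i \<in> sets unit_leb"
    and S_pos: "\<And>i. i \<in> {1..n} \<Longrightarrow> 0 < measure unit_leb (S i)"
    and sep: "\<And>i. i \<in> {1..<n} \<Longrightarrow> 2 * ess_sup_on (S (i + 1)) w \<le> ess_inf_on (S i) w"
begin

text \<open>The hypothesis compares neighbours; induction on \<open>j\<close> extends the comparison
  to every later set, because the essential infima do not increase along the family.\<close>

lemma twice_weight_le_ess_inf:
  assumes "1 \<le> i" "i < j" "j \<le> n"
  shows "AE u in unit_leb. u \<in> S j \<longrightarrow> ereal (2 * w u) \<le> ess_inf_on (S i) w"
proof -
  have next_le: "AE u in unit_leb. u \<in> S (i + 1) \<longrightarrow> ereal (2 * w u) \<le> ess_inf_on (S i) w"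
    if i: "i \<in> {1..<n}" for i
  proof -
    have "S (i + 1) \<in> sets unit_leb" using i by (intro S) auto
    from le_ess_sup_on[OF this, of w] show ?thesis
    proof eventually_elim
      case (elim u)
      show ?case
      proof
        assume "u \<in> S (i + 1)"
        with elim have "2 * ereal (w u) \<le> 2 * ess_sup_on (S (i + 1)) w"
          by (intro ereal_mult_left_mono) auto
        also note sep[OF i]
        finally show "ereal (2 * w u) \<le> ess_inf_on (S i) w" by simp
      qed
    qed
  qed
  from \<open>i < j\<close> have "Suc i \<le> j" by simp
  then show ?thesis using \<open>j \<le> n\<close>
  proof (induction j rule: dec_induct)
    case base
    then show ?case using next_le[of i] assms by simp
  next
    case (step j)
    have j: "j \<in> {1..n}" using step assms by auto
    have IH: "AE u in unit_leb. u \<in> S j \<longrightarrow> ereal (2 * w u) \<le> ess_inf_on (S i) w"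
      using step by simp
    \<comment> \<open>A single point \<open>v\<close> of \<open>S j\<close> suffices: the essential
      infimum over \<open>S j\<close> is at most \<open>w v\<close>, hence at most
      \<open>2 * w v\<close>, hence at most the essential infimum over \<open>S i\<close>.\<close>
    have "AE u in unit_leb. 0 < w u \<and> (u \<in> S j \<longrightarrow> ereal (2 * w u) \<le> ess_inf_on (S i) w)
        \<and> (u \<in> S j \<longrightarrow> ess_inf_on (S j) w \<le> ereal (w u))"
      using w_pos IH ess_inf_on_le[OF S[OF j], of w] by eventually_elim simp
    from exists_point_AE[OF S[OF j] S_pos[OF j] this]
    obtain v where v: "0 < w v" "ereal (2 * w v) \<le> ess_inf_on (S i) w"
      "ess_inf_on (S j) w \<le> ereal (w v)" by blast
    have "ess_inf_on (S j) w \<le> ereal (w v)" by fact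
    also have "\<dots> \<le> ereal (2 * w v)" using v(1) by simp
    also note v(2)
    finally have le: "ess_inf_on (S j) w \<le> ess_inf_on (S i) w" .
    have "j \<in> {1..<n}" using step assms by auto
    from next_le[OF this]
    show ?case by eventually_elim (use le in auto)
  qed
qed

text \<open>At a common point the separation would give \<open>2 * w u \<le> w u\<close> although
  \<open>w u\<close> is positive.\<close>

lemma AE_disjoint:
  assumes "i \<in> {1..n}" "j \<in> {1..n}" "i \<noteq> j"
  shows "AE u in unit_leb. \<not> (u \<in> S i \<and> u \<in> S j)"
proof -
  have "AE u in unit_leb. \<not> (u \<in> S i \<and> u \<in> S j)" if ij: "1 \<le> i" "i < j" "j \<le> n" for i j
  proof -
    have i: "i \<in> {1..n}" using ij by auto
    show ?thesis
      using twice_weight_le_ess_inf[OF ij] ess_inf_on_le[OF S[OF i], of w] w_pos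
    proof eventually_elim
      case (elim u)
      show ?case
      proof
        assume "u \<in> S i \<and> u \<in> S j"
        with elim have "ereal (2 * w u) \<le> ereal (w u)" by (meson order_trans)
        with elim show False by simp
      qed
    qed
  qed
  from this[of i j] this[of j i] show ?thesis
    using assms by (cases "i < j") (auto elim: AE_mp)
qed

text \<open>Within one level set the weight varies by a factor strictly below \<open>2\<close>,
  whereas its values on two different members of the family differ almost everywhere by a factor of
  at least \<open>2\<close>.\<close>

lemma level_set_meets_one:
  assumes "i \<in> {1..n}" "j \<in> {1..n}" "i \<noteq> j"
    and pos: "0 < measure unit_leb (S i \<inter> level_set w k)"
  shows "measure unit_leb (S j \<inter> level_set w k) = 0"
proof -
  have False if ij: "1 \<le> i" "i < j" "j \<le> n"
    and p: "0 < measure unit_leb (S i \<inter> level_set w k)"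
      "0 < measure unit_leb (S j \<inter> level_set w k)" for i j
  proof -
    have i: "i \<in> {1..n}" and j: "j \<in> {1..n}" using ij by auto
    have si: "S i \<inter> level_set w k \<in> sets unit_leb" using S[OF i] level_set_sets[OF w] by blast
    have sj: "S j \<inter> level_set w k \<in> sets unit_leb" using S[OF j] level_set_sets[OF w] by blast
    obtain u where u: "u \<in> S i \<inter> level_set w k" "ess_inf_on (S i) w \<le> ereal (w u)"
      using exists_point_AE[OF si p(1) ess_inf_on_le[OF S[OF i], of w]] by blast
    obtain v where v: "v \<in> S j \<inter> level_set w k" "ereal (2 * w v) \<le> ess_inf_on (S i) w"
      using exists_point_AE[OF sj p(2) twice_weight_le_ess_inf[OF ij]] by blast
    have "ereal (2 * w v) \<le> ereal (w u)" using u(2) v(2) by order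
    then have "2 * w v \<le> w u" by simp
    moreover have "2 powi k \<le> w v" "w u < 2 powi (k + 1)"
      using u(1) v(1) by (auto simp: level_set_def)
    ultimately show False by (simp add: power_int_add)
  qed
  then show ?thesis using assms
    by (metis atLeastAtMost_iff linorder_neqE_nat zero_less_measure_iff)
qed

end

lemma sums_measure_level_sets:
  assumes w: "w \<in> borel_measurable unit_leb" and "inj \<kappa>"
    and cover: "AE t in unit_leb. \<exists>r. t \<in> level_set w (\<kappa> r)" and B: "B \<in> sets unit_leb"
  shows "(\<lambda>r. measure unit_leb (B \<inter> level_set w (\<kappa> r))) sums measure unit_leb B"
proof -
  have sets: "B \<inter> level_set w (\<kappa> r) \<in> sets unit_leb" for r
    using B level_set_sets[OF w] by blast
  have "(\<lambda>r. measure unit_leb (B \<inter> level_set w (\<kappa> r))) sums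
      measure unit_leb (\<Union>r. B \<inter> level_set w (\<kappa> r))"
  proof (rule unit_leb.finite_measure_UNION)
    show "disjoint_family (\<lambda>r. B \<inter> level_set w (\<kappa> r))"
      unfolding disjoint_family_on_def
    proof (intro ballI impI)
      fix r s :: nat assume "r \<noteq> s"
      then have "\<kappa> r \<noteq> \<kappa> s" using \<open>inj \<kappa>\<close> by (auto dest: injD)
      then show "B \<inter> level_set w (\<kappa> r) \<inter> (B \<inter> level_set w (\<kappa> s)) = {}"
        using level_set_disjoint[of "\<kappa> r" "\<kappa> s" w] by blast
    qed
  qed (use sets in auto)
  also have "measure unit_leb (\<Union>r. B \<inter> level_set w (\<kappa> r)) = measure unit_leb B"
    proof (rule measure_eq_AE)
    show "(\<Union>r. B \<inter> level_set w (\<kappa> r)) \<in> sets unit_leb"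
      using sets by (intro sets.countable_UN) auto
  qed (use cover B in auto)
  finally show ?thesis .
qed

lemma weight_seq_sums:
  assumes w: "w \<in> borel_measurable unit_leb" and "inj \<kappa>"
    and cover: "AE t in unit_leb. \<exists>r. t \<in> level_set w (\<kappa> r)"
    and eq: "\<And>r. weight_seq w r = measure unit_leb (level_set w (\<kappa> r))"
  shows "weight_seq w sums 1"
proof -
  have "(\<lambda>r. measure unit_leb ({0..1} \<inter> level_set w (\<kappa> r))) sums measure unit_leb {0..1}"
    by (rule sums_measure_level_sets[OF w \<open>inj \<kappa>\<close> cover]) (auto intro: sets_unit_lebI)
  moreover have "{0..1} \<inter> level_set w j = level_set w j" for j by (auto simp: level_set_def)
  moreover have "measure unit_leb {0..1} = 1" by (simp add: measure_unit_leb)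
  ultimately show ?thesis by (simp add: eq[abs_def])
qed

lemma sets_supp:
  assumes [measurable]: "x \<in> borel_measurable unit_leb"
  shows "supp x \<in> sets unit_leb"
proof -
  have "{u \<in> space unit_leb. x u \<noteq> 0} \<in> sets unit_leb" by measurable
  then show ?thesis by (simp add: supp_def)
qed

section \<open>From sums of \<open>tilde \<phi>\<close> to norms of separated sums\<close>

context marcinkiewicz_function
begin

text \<open>Vanishing terms are replaced by small positive ones, whose total is at most that of the
  given sequence.\<close>

lemma sum_tilde_le_with_zeros:
  assumes v: "\<And>r. 0 < v r" "summable v" "(\<Sum>r. v r) \<le> 1" and "0 < C"
    and H: "\<And>\<tau>. (\<And>r. 0 < \<tau> r \<and> \<tau> r \<le> v r) \<Longrightarrow>
      (\<Sum>r. ennreal (tilde \<phi> (\<tau> r))) \<le> ennreal (C * tilde \<phi> (\<Sum>r. \<tau> r))"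
    and \<tau>: "\<And>r. 0 \<le> \<tau> r" "\<And>r. \<tau> r \<le> v r"
  shows "(\<Sum>r. ennreal (tilde \<phi> (\<tau> r))) \<le> ennreal (2 * C * tilde \<phi> (\<Sum>r. \<tau> r))"
proof -
  let ?s = "\<Sum>r. \<tau> r"
  have sm: "summable \<tau>" using \<tau> v(2) by (auto intro: summable_comparison_test')
  show ?thesis
  proof (cases "?s = 0")
    case True
    then have "\<tau> r = 0" for r using suminf_eq_zero_iff[OF sm \<tau>(1)] by simp
    then show ?thesis by simp
  next
    case False
    then have s: "0 < ?s" using suminf_nonneg[OF sm \<tau>(1)] by simp
    \<comment> \<open>The factors \<open>(1 / 2) ^ Suc r\<close> sum to \<open>1\<close>, so at most
      \<open>?s\<close> is added in total; the minimum with \<open>v r\<close> keeps the new terms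
      admissible.\<close>
    define \<epsilon> where "\<epsilon> r = (if \<tau> r = 0 then min (v r) (?s * (1 / 2) ^ Suc r) else 0)" for r
    have geo: "(\<lambda>r. ?s * (1 / 2) ^ Suc r) sums (?s * 1)"
      by (intro sums_mult power_half_series)
    have e0: "0 \<le> \<epsilon> r" for r using s v(1)[of r] by (simp add: \<epsilon>_def)
    have e1: "\<epsilon> r \<le> ?s * (1 / 2) ^ Suc r" for r
    proof -
      have "0 \<le> ?s * (1 / 2) ^ Suc r" using s by simp
      then show ?thesis unfolding \<epsilon>_def by (simp only: min.cobounded2 split: if_split) blast
    qed
    have esm: "summable \<epsilon>"
      by (rule summable_comparison_test'[OF sums_summable[OF geo], of 0]) (use e0 e1 in simp)
    have ele: "(\<Sum>r. \<epsilon> r) \<le> ?s"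
      using suminf_le[OF e1 esm sums_summable[OF geo]] sums_unique[OF geo] by simp
    have pos: "0 < \<tau> r + \<epsilon> r \<and> \<tau> r + \<epsilon> r \<le> v r" for r
    proof (cases "\<tau> r = 0")
      case True
      have "0 < ?s * (1 / 2) ^ Suc r" using s by simp
      then show ?thesis using True v(1)[of r] by (simp add: \<epsilon>_def)
    next
      case False
      then show ?thesis using \<tau>[of r] by (simp add: \<epsilon>_def)
    qed
    have sum: "(\<Sum>r. \<tau> r + \<epsilon> r) = ?s + (\<Sum>r. \<epsilon> r)"
      by (rule suminf_add[OF sm esm, symmetric])
    have total: "?s + (\<Sum>r. \<epsilon> r) \<le> 1"
      using suminf_le[of "\<lambda>r. \<tau> r + \<epsilon> r" v] pos summable_add[OF sm esm] v(2,3) sum by simp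
    have enn: "0 \<le> (\<Sum>r. \<epsilon> r)" by (rule suminf_nonneg[OF esm e0])
    have vle: "v r \<le> 1" for r
      using sum_le_suminf[OF v(2), of "{r}"] v(1,3) by (simp add: less_imp_le)
    have "(\<Sum>r. ennreal (tilde \<phi> (\<tau> r))) \<le> (\<Sum>r. ennreal (tilde \<phi> (\<tau> r + \<epsilon> r)))"
    proof (intro suminf_le ennreal_leI tilde_mono)
      fix r
      show "\<tau> r + \<epsilon> r \<le> 1" using pos[of r] vle[of r] by linarith
    qed (use \<tau> e0 in auto)
    also have "\<dots> \<le> ennreal (C * tilde \<phi> (?s + (\<Sum>r. \<epsilon> r)))"
      using H[of "\<lambda>r. \<tau> r + \<epsilon> r"] pos unfolding sum by blast
    \<comment> \<open>The added mass is at most \<open>?s\<close>, so by subadditivity and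
      monotonicity \<open>tilde \<phi>\<close> of the total at most doubles.\<close>
    also have "\<dots> \<le> ennreal (2 * C * tilde \<phi> ?s)"
    proof (rule ennreal_leI)
      have "tilde \<phi> (?s + (\<Sum>r. \<epsilon> r)) \<le> tilde \<phi> ?s + tilde \<phi> (\<Sum>r. \<epsilon> r)"
        using s enn total by (intro tilde_add_le) auto
      also have "\<dots> \<le> tilde \<phi> ?s + tilde \<phi> ?s"
        using s enn ele total by (intro add_left_mono tilde_mono) auto
      finally have "C * tilde \<phi> (?s + (\<Sum>r. \<epsilon> r)) \<le> C * (tilde \<phi> ?s + tilde \<phi> ?s)"
        using \<open>0 < C\<close> by (intro mult_left_mono) auto
      then show "C * tilde \<phi> (?s + (\<Sum>r. \<epsilon> r)) \<le> 2 * C * tilde \<phi> ?s" by simp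
    qed
    finally show ?thesis .
  qed
qed

text \<open>Countable subadditivity splits each \<open>A \<inter> S i\<close> along the level sets.
  After exchanging the sums, each level carries at most one nonzero term, as it meets at most one
  \<open>S i\<close> in positive measure, and monotonicity of \<open>tilde \<phi>\<close> bounds
  that term.\<close>

lemma sum_tilde_separated_le:
  assumes "separated_family w n S" and "inj \<kappa>"
    and cover: "AE t in unit_leb. \<exists>r. t \<in> level_set w (\<kappa> r)" and A: "A \<in> sets unit_leb"
  shows "(\<Sum>i=1..n. ennreal (tilde \<phi> (measure unit_leb (A \<inter> S i)))) \<le>
    (\<Sum>r. ennreal (tilde \<phi> (measure unit_leb (A \<inter> level_set w (\<kappa> r)))))"
proof -
  interpret separated_family w n S by fact
  let ?m = "\<lambda>i r. measure unit_leb (A \<inter> S i \<inter> level_set w (\<kappa> r))"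
  have "(\<Sum>i=1..n. ennreal (tilde \<phi> (measure unit_leb (A \<inter> S i)))) \<le>
      (\<Sum>i=1..n. \<Sum>r. ennreal (tilde \<phi> (?m i r)))"
  proof (rule sum_mono)
    fix i assume i: "i \<in> {1..n}"
    have "?m i sums measure unit_leb (A \<inter> S i)"
      using S[OF i] A by (intro sums_measure_level_sets[OF w \<open>inj \<kappa>\<close> cover]) auto
    then show "ennreal (tilde \<phi> (measure unit_leb (A \<inter> S i))) \<le> (\<Sum>r. ennreal (tilde \<phi> (?m i r)))"
      using tilde_suminf_le[of "?m i"] by (simp add: sums_iff)
  qed
  also have "\<dots> = (\<Sum>r. \<Sum>i=1..n. ennreal (tilde \<phi> (?m i r)))"
    by (rule suminf_sum[symmetric]) simp
  also have "\<dots> \<le> (\<Sum>r. ennreal (tilde \<phi> (measure unit_leb (A \<inter> level_set w (\<kappa> r)))))"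
  proof (rule suminf_le)
    fix r
    show "(\<Sum>i=1..n. ennreal (tilde \<phi> (?m i r))) \<le>
        ennreal (tilde \<phi> (measure unit_leb (A \<inter> level_set w (\<kappa> r))))"
    proof (cases "\<exists>i\<in>{1..n}. ?m i r \<noteq> 0")
      case True
      then obtain i where i: "i \<in> {1..n}" "?m i r \<noteq> 0" by blast
      have ls: "S j \<inter> level_set w (\<kappa> r) \<in> sets unit_leb" if "j \<in> {1..n}" for j
        using S[OF that] level_set_sets[OF w] by blast
      have mle: "?m j r \<le> measure unit_leb (S j \<inter> level_set w (\<kappa> r))" if "j \<in> {1..n}" for j
        using ls[OF that] by (intro unit_leb.finite_measure_mono) auto
      have "0 < measure unit_leb (S i \<inter> level_set w (\<kappa> r))"
        using mle[OF i(1)] i(2) by (metis less_le_trans zero_less_measure_iff)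
      then have "?m j r = 0" if "j \<in> {1..n}" "j \<noteq> i" for j
        using level_set_meets_one[OF i(1) that(1)] that mle[OF that(1)]
        by (metis measure_le_0_iff)
      then have "(\<Sum>j=1..n. ennreal (tilde \<phi> (?m j r))) =
          (\<Sum>j=1..n. if j = i then ennreal (tilde \<phi> (?m i r)) else 0)"
        by (intro sum.cong) auto
      also have "\<dots> = ennreal (tilde \<phi> (?m i r))" using i(1) by simp
      also have "\<dots> \<le> ennreal (tilde \<phi> (measure unit_leb (A \<inter> level_set w (\<kappa> r))))"
        using A level_set_sets[OF w, of "\<kappa> r"]
        by (intro ennreal_leI tilde_mono unit_leb.finite_measure_mono) auto
      finally show ?thesis .
    next
      case False
      then have "(\<Sum>i=1..n. ennreal (tilde \<phi> (?m i r))) = 0" by (intro sum.neutral) auto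
      then show ?thesis by simp
    qed
  qed auto
  finally show ?thesis .
qed

text \<open>Each \<open>y i\<close> contributes to the integral over \<open>A\<close> at most the
  norm of the whole sum of the \<open>x j\<close> times \<open>tilde \<phi>\<close> of the measure
  of \<open>A \<inter> S i\<close>; these factors add up to at most \<open>K\<close> times
  \<open>tilde \<phi>\<close> of the measure of \<open>A\<close>.\<close>

lemma norm_sum_le_norm_sum:
  assumes "separated_family w n S" and "inj \<kappa>"
    and cover: "AE t in unit_leb. \<exists>r. t \<in> level_set w (\<kappa> r)"
    and x: "\<And>i. i \<in> {1..n} \<Longrightarrow> x i \<in> borel_measurable unit_leb"
    and y: "\<And>i. i \<in> {1..n} \<Longrightarrow> y i \<in> borel_measurable unit_leb"
    and xS: "\<And>i. i \<in> {1..n} \<Longrightarrow> supp (x i) \<subseteq> S i"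
    and yS: "\<And>i. i \<in> {1..n} \<Longrightarrow> supp (y i) \<subseteq> S i"
    and le: "\<And>i. i \<in> {1..n} \<Longrightarrow> marcinkiewicz_norm \<phi> (y i) \<le> marcinkiewicz_norm \<phi> (x i)"
    and K: "\<And>A. A \<in> sets unit_leb \<Longrightarrow>
      (\<Sum>r. ennreal (tilde \<phi> (measure unit_leb (A \<inter> level_set w (\<kappa> r)))))
        \<le> K * ennreal (tilde \<phi> (measure unit_leb A))"
  shows "marcinkiewicz_norm \<phi> (\<lambda>t. \<Sum>i=1..n. y i t) \<le>
    K * marcinkiewicz_norm \<phi> (\<lambda>t. \<Sum>i=1..n. x i t)"
proof -
  interpret separated_family w n S by fact
  let ?N = "marcinkiewicz_norm \<phi> (\<lambda>t. \<Sum>i=1..n. x i t)"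
  have mx: "(\<lambda>t. \<Sum>i=1..n. x i t) \<in> borel_measurable unit_leb"
    and my: "(\<lambda>t. \<Sum>i=1..n. y i t) \<in> borel_measurable unit_leb"
    by (intro borel_measurable_sum x y; simp)+
  \<comment> \<open>Almost everywhere at most one \<open>x j\<close> is nonzero, so the sum has
    absolute value at least \<open>\<bar>x i\<bar>\<close>.\<close>
  have xN: "marcinkiewicz_norm \<phi> (x i) \<le> ?N" if i: "i \<in> {1..n}" for i
  proof (rule norm_mono_AE[OF x[OF i] mx])
    have "AE u in unit_leb. \<forall>j\<in>{1..n}. j \<noteq> i \<longrightarrow> \<not> (u \<in> S i \<and> u \<in> S j)"
    proof (rule AE_finite_allI)
      fix j assume "j \<in> {1..n}"
      then show "AE u in unit_leb. j \<noteq> i \<longrightarrow> \<not> (u \<in> S i \<and> u \<in> S j)"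
        using AE_disjoint[OF i, of j] by (cases "j = i") auto
    qed simp
    then show "AE u in unit_leb. \<bar>x i u\<bar> \<le> \<bar>\<Sum>j=1..n. x j u\<bar>" using AE_space
    proof eventually_elim
      case (elim u)
      show ?case
      proof (cases "x i u = 0")
        case False
        with elim have "u \<in> S i" using xS[OF i] by (auto simp: supp_def)
        have "x j u = 0" if "j \<in> {1..n}" "j \<noteq> i" for j
        proof (rule ccontr)
          assume "x j u \<noteq> 0"
          then have "u \<in> S j" using elim xS[OF that(1)] by (auto simp: supp_def)
          then show False using elim that \<open>u \<in> S i\<close> by blast
        qed
        then have "(\<Sum>j=1..n. x j u) = (\<Sum>j=1..n. if j = i then x i u else 0)"
          by (intro sum.cong) auto
        also have "\<dots> = x i u" using i by simp
        finally show ?thesis by simp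
      qed simp
    qed
  qed
  show ?thesis
  proof (rule norm_le[OF my])
    fix A assume A: "A \<in> sets unit_leb"
    have "(\<integral>\<^sup>+ u\<in>A. ennreal \<bar>\<Sum>i=1..n. y i u\<bar> \<partial>unit_leb) \<le>
        (\<integral>\<^sup>+ u. (\<Sum>i=1..n. ennreal \<bar>y i u\<bar> * indicator (A \<inter> S i) u) \<partial>unit_leb)"
    proof (rule nn_integral_mono)
      fix u assume u: "u \<in> space unit_leb"
      have "ennreal \<bar>\<Sum>i=1..n. y i u\<bar> * indicator A u \<le> ennreal (\<Sum>i=1..n. \<bar>y i u\<bar>) * indicator A u"
        by (intro mult_right_mono ennreal_leI sum_abs) auto
      also have "\<dots> = (\<Sum>i=1..n. ennreal \<bar>y i u\<bar> * indicator A u)"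
        by (simp add: sum_ennreal flip: sum_distrib_right)
      also have "\<dots> = (\<Sum>i=1..n. ennreal \<bar>y i u\<bar> * indicator (A \<inter> S i) u)"
      proof (rule sum.cong)
        fix i assume "i \<in> {1..n}"
        then have "y i u = 0 \<or> u \<in> S i" using yS[of i] u by (auto simp: supp_def)
        then show "ennreal \<bar>y i u\<bar> * indicator A u = ennreal \<bar>y i u\<bar> * indicator (A \<inter> S i) u"
          by (auto split: split_indicator)
      qed simp
      finally show "ennreal \<bar>\<Sum>i=1..n. y i u\<bar> * indicator A u \<le> \<dots>" .
    qed
    also have "\<dots> = (\<Sum>i=1..n. \<integral>\<^sup>+ u\<in>A \<inter> S i. ennreal \<bar>y i u\<bar> \<partial>unit_leb)"
    proof (rule nn_integral_sum)
      fix i assume i: "i \<in> {1..n}"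
      have "A \<inter> S i \<in> sets unit_leb" using A S[OF i] by blast
      then show "(\<lambda>u. ennreal \<bar>y i u\<bar> * indicator (A \<inter> S i) u) \<in> borel_measurable unit_leb"
        using y[OF i] by measurable
    qed
    also have "\<dots> \<le> (\<Sum>i=1..n. ?N * ennreal (tilde \<phi> (measure unit_leb (A \<inter> S i))))"
    proof (rule sum_mono)
      fix i assume i: "i \<in> {1..n}"
      have "A \<inter> S i \<in> sets unit_leb" using A S[OF i] by blast
      from set_nn_integral_le_norm[OF y[OF i] this]
      have "(\<integral>\<^sup>+ u\<in>A \<inter> S i. ennreal \<bar>y i u\<bar> \<partial>unit_leb) \<le>
        marcinkiewicz_norm \<phi> (y i) * ennreal (tilde \<phi> (measure unit_leb (A \<inter> S i)))" .
      also have "\<dots> \<le> ?N * ennreal (tilde \<phi> (measure unit_leb (A \<inter> S i)))"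
        using le[OF i] xN[OF i] by (intro mult_right_mono) auto
      finally show "(\<integral>\<^sup>+ u\<in>A \<inter> S i. ennreal \<bar>y i u\<bar> \<partial>unit_leb) \<le> \<dots>" .
    qed
    also have "\<dots> = ?N * (\<Sum>i=1..n. ennreal (tilde \<phi> (measure unit_leb (A \<inter> S i))))"
      by (simp add: sum_distrib_left)
    also have "\<dots> \<le> ?N * (K * ennreal (tilde \<phi> (measure unit_leb A)))"
      using sum_tilde_separated_le[OF \<open>separated_family w n S\<close> \<open>inj \<kappa>\<close> cover A] K[OF A]
      by (intro mult_left_mono) auto
    finally show "(\<integral>\<^sup>+ u\<in>A. ennreal \<bar>\<Sum>i=1..n. y i u\<bar> \<partial>unit_leb) \<le>
        K * ?N * ennreal (tilde \<phi> (measure unit_leb A))"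
      by (simp add: ac_simps)
  qed
qed

end

section \<open>Necessity\<close>

lemma set_nn_integral_sum_indicators:
  assumes A: "\<And>i. i \<in> I \<Longrightarrow> A i \<in> sets unit_leb" and B: "B \<in> sets unit_leb"
    and c: "\<And>i. i \<in> I \<Longrightarrow> 0 \<le> c i"
  shows "(\<integral>\<^sup>+ u\<in>B. ennreal \<bar>\<Sum>i\<in>I. c i * indicator (A i) u\<bar> \<partial>unit_leb) =
    ennreal (\<Sum>i\<in>I. c i * measure unit_leb (A i \<inter> B))"
proof -
  have "(\<integral>\<^sup>+ u\<in>B. ennreal \<bar>\<Sum>i\<in>I. c i * indicator (A i) u\<bar> \<partial>unit_leb) =
      (\<integral>\<^sup>+ u. (\<Sum>i\<in>I. ennreal \<bar>c i * indicator (A i) u\<bar> * indicator B u) \<partial>unit_leb)"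
  proof (rule nn_integral_cong)
    fix u
    have nn: "0 \<le> c i * indicator (A i) u" if "i \<in> I" for i using c[OF that] by simp
    have "ennreal \<bar>\<Sum>i\<in>I. c i * indicator (A i) u\<bar> = ennreal (\<Sum>i\<in>I. c i * indicator (A i) u)"
      using nn by (simp add: sum_nonneg)
    also have "\<dots> = (\<Sum>i\<in>I. ennreal (c i * indicator (A i) u))"
      using nn by (intro sum_ennreal[symmetric])
    also have "\<dots> = (\<Sum>i\<in>I. ennreal \<bar>c i * indicator (A i) u\<bar>)"
      using nn by (intro sum.cong refl) (simp only: abs_of_nonneg)
    finally show "ennreal \<bar>\<Sum>i\<in>I. c i * indicator (A i) u\<bar> * indicator B u =
        (\<Sum>i\<in>I. ennreal \<bar>c i * indicator (A i) u\<bar> * indicator B u)"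
      by (simp only: sum_distrib_right)
  qed
  also have "\<dots> = (\<Sum>i\<in>I. \<integral>\<^sup>+ u\<in>B. ennreal \<bar>c i * indicator (A i) u\<bar> \<partial>unit_leb)"
    by (rule nn_integral_sum) (use A B in measurable)
  also have "\<dots> = (\<Sum>i\<in>I. ennreal (c i * measure unit_leb (A i \<inter> B)))"
    using A B c by (intro sum.cong refl set_nn_integral_scaled_indicator) auto
  also have "\<dots> = ennreal (\<Sum>i\<in>I. c i * measure unit_leb (A i \<inter> B))"
    using c by (intro sum_ennreal) auto
  finally show ?thesis .
qed

lemma nonzero_fun_indicator:
  assumes "A \<in> sets unit_leb" "0 < measure unit_leb A" "c \<noteq> 0"
  shows "nonzero_fun (\<lambda>u. c * indicator A u)"
  unfolding nonzero_fun_def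
proof
  assume "AE u in unit_leb. c * indicator A u = 0"
  from exists_point_AE[OF assms(1,2) this] show False using assms(3) by auto
qed

lemma ess_sup_on_le:
  assumes w: "w \<in> borel_measurable unit_leb" and S: "S \<in> sets unit_leb" "S \<subseteq> level_set w k"
  shows "ess_sup_on S w \<le> ereal (2 powi (k + 1))"
  unfolding ess_sup_on_def
proof (rule esssup_I)
  show "(\<lambda>t. ereal (w t)) \<in> borel_measurable (lebesgue_on S)"
    using borel_measurable_lebesgue_on_subset[OF w S(1)] by measurable
  show "AE t in lebesgue_on S. ereal (w t) \<le> ereal (2 powi (k + 1))"
    unfolding AE_lebesgue_on_subset[OF S(1)] using S(2) by (intro AE_I2) (auto simp: level_set_def)
qed

lemma le_ess_inf_on:
  assumes w: "w \<in> borel_measurable unit_leb" and S: "S \<in> sets unit_leb" "S \<subseteq> level_set w k"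
  shows "ereal (2 powi k) \<le> ess_inf_on S w"
proof -
  have "esssup (lebesgue_on S) (\<lambda>t. - ereal (w t)) \<le> - ereal (2 powi k)"
  proof (rule esssup_I)
    show "(\<lambda>t. - ereal (w t)) \<in> borel_measurable (lebesgue_on S)"
      using borel_measurable_lebesgue_on_subset[OF w S(1)] by measurable
    show "AE t in lebesgue_on S. - ereal (w t) \<le> - ereal (2 powi k)"
      unfolding AE_lebesgue_on_subset[OF S(1)] using S(2) by (intro AE_I2) (auto simp: level_set_def)
  qed
  then show ?thesis unfolding ess_inf_on_def by (metis ereal_uminus_le_reorder ereal_uminus_uminus)
qed

text \<open>Keeps the upper estimate; the lower one is the same inequality with \<open>x\<close> and
  \<open>y\<close> exchanged.\<close>

lemma w_decomposableE:
  assumes "w_decomposable w X N"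
  obtains C where "0 < C" "\<And>n (x :: nat \<Rightarrow> real \<Rightarrow> real) y. 1 \<le> n \<Longrightarrow>
      (\<forall>i\<in>{1..n}. x i \<in> X \<and> y i \<in> X \<and> nonzero_fun (x i) \<and> nonzero_fun (y i) \<and>
        N (x i) = N (y i)) \<Longrightarrow>
      (\<forall>i\<in>{1..<n}. 2 * ess_sup_on (supp (x (i + 1)) \<union> supp (y (i + 1))) w
        \<le> ess_inf_on (supp (x i) \<union> supp (y i)) w) \<Longrightarrow>
      N (\<lambda>t. \<Sum>i=1..n. y i t) \<le> ennreal C * N (\<lambda>t. \<Sum>i=1..n. x i t)"
proof -
  from assms[unfolded w_decomposable_def] show thesis
  proof (elim exE conjE)
    fix C :: real
    assume "0 < C"
    assume H: "\<forall>n\<ge>1. \<forall>x y :: nat \<Rightarrow> real \<Rightarrow> real.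
          (\<forall>i\<in>{1..n}. x i \<in> X \<and> y i \<in> X \<and> nonzero_fun (x i) \<and> nonzero_fun (y i) \<and>
                      N (x i) = N (y i)) \<longrightarrow>
          (\<forall>i\<in>{1..<n}. 2 * ess_sup_on (supp (x (i + 1)) \<union> supp (y (i + 1))) w
                        \<le> ess_inf_on (supp (x i) \<union> supp (y i)) w) \<longrightarrow>
          ennreal (1 / C) * N (\<lambda>t. \<Sum>i=1..n. x i t) \<le> N (\<lambda>t. \<Sum>i=1..n. y i t) \<and>
          N (\<lambda>t. \<Sum>i=1..n. y i t) \<le> ennreal C * N (\<lambda>t. \<Sum>i=1..n. x i t)"
    show thesis
    proof (rule that[OF \<open>0 < C\<close>])
      fix n :: nat and x y :: "nat \<Rightarrow> real \<Rightarrow> real"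
      assume 1: "1 \<le> n"
        "\<forall>i\<in>{1..n}. x i \<in> X \<and> y i \<in> X \<and> nonzero_fun (x i) \<and> nonzero_fun (y i) \<and>
          N (x i) = N (y i)"
        "\<forall>i\<in>{1..<n}. 2 * ess_sup_on (supp (x (i + 1)) \<union> supp (y (i + 1))) w
          \<le> ess_inf_on (supp (x i) \<union> supp (y i)) w"
      from H[THEN spec, THEN mp, OF 1(1), THEN spec, THEN spec, THEN mp, OF 1(2), THEN mp, OF 1(3)]
      show "N (\<lambda>t. \<Sum>i=1..n. y i t) \<le> ennreal C * N (\<lambda>t. \<Sum>i=1..n. x i t)" ..
    qed
  qed
qed

section \<open>Normalized indicators as test functions for decomposability\<close>

context marcinkiewicz_function
begin

text \<open>Each term is at most \<open>q\<close> times its predecessor, so the first term dominates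
  a geometric series. The induction lowers the starting index from \<open>n\<close> to
  \<open>m\<close>, using \<open>1 + q / (1 - q) = 1 / (1 - q)\<close>.\<close>

lemma sum_tilde_geometric_le:
  assumes T: "1 < T" and q: "0 < q" "q < 1"
    and contr: "\<And>s. 0 < s \<Longrightarrow> s * T \<le> 1 \<Longrightarrow> tilde \<phi> s \<le> q * tilde \<phi> (s * T)"
    and \<beta>: "0 < \<beta>" "\<beta> \<le> 1" and "m \<le> n"
  shows "(\<Sum>i=m..n. tilde \<phi> (\<beta> / T ^ i)) \<le> tilde \<phi> (\<beta> / T ^ m) / (1 - q)"
  using \<open>m \<le> n\<close>
proof (induction m rule: inc_induct)
  case base
  have "\<beta> / T ^ n \<le> 1" "0 < \<beta> / T ^ n"
    using \<beta> T one_le_power[of T n] by (auto simp: divide_le_eq intro: order_trans)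
  then have "0 \<le> tilde \<phi> (\<beta> / T ^ n)" by (intro tilde_nonneg) auto
  then show ?case using q by (simp add: le_divide_eq mult_right_le_one_le)
next
  case (step m)
  have 1: "\<beta> / T ^ Suc m * T = \<beta> / T ^ m" using T by simp
  have "\<beta> / T ^ m \<le> 1" "0 < \<beta> / T ^ Suc m"
    using \<beta> T one_le_power[of T m] by (auto simp: divide_le_eq intro: order_trans)
  then have c: "tilde \<phi> (\<beta> / T ^ Suc m) \<le> q * tilde \<phi> (\<beta> / T ^ m)"
    using contr[of "\<beta> / T ^ Suc m"] unfolding 1 by blast
  have "(\<Sum>i=m..n. tilde \<phi> (\<beta> / T ^ i)) =
      tilde \<phi> (\<beta> / T ^ m) + (\<Sum>i=Suc m..n. tilde \<phi> (\<beta> / T ^ i))"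
    using step by (intro sum.atLeast_Suc_atMost) auto
  also have "\<dots> \<le> tilde \<phi> (\<beta> / T ^ m) + tilde \<phi> (\<beta> / T ^ Suc m) / (1 - q)"
    using step by simp
  also have "\<dots> \<le> tilde \<phi> (\<beta> / T ^ m) + q * tilde \<phi> (\<beta> / T ^ m) / (1 - q)"
    using c q by (intro add_left_mono divide_right_mono) auto
  also have "\<dots> = tilde \<phi> (\<beta> / T ^ m) / (1 - q)"
    using q by (simp add: field_simps)
  finally show ?case .
qed

text \<open>Normalized indicators of disjoint sets of geometrically decreasing measure behave like a
  single one: on a test set of measure \<open>b\<close>, the sets smaller than \<open>b\<close> contribute a geometric
  series, and the larger ones at most \<open>b / \<phi> b\<close> altogether by disjointness.\<close>

lemma norm_geometric_indicators_le:
  assumes T: "1 < T" and q: "0 < q" "q < 1"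
    and contr: "\<And>s. 0 < s \<Longrightarrow> s * T \<le> 1 \<Longrightarrow> tilde \<phi> s \<le> q * tilde \<phi> (s * T)"
    and \<beta>: "0 < \<beta>" "\<beta> \<le> 1"
    and A: "\<And>i. i \<in> {1..n} \<Longrightarrow> A i \<in> sets unit_leb" and disj: "disjoint_family_on A {1..n}"
    and mA: "\<And>i. i \<in> {1..n} \<Longrightarrow> measure unit_leb (A i) = \<beta> / T ^ i"
  shows "marcinkiewicz_norm \<phi> (\<lambda>u. \<Sum>i=1..n. 1 / \<phi> (\<beta> / T ^ i) * indicator (A i) u)
    \<le> ennreal (1 + 1 / (1 - q))"
proof (rule norm_le)
  show "(\<lambda>u. \<Sum>i=1..n. 1 / \<phi> (\<beta> / T ^ i) * indicator (A i) u) \<in> borel_measurable unit_leb"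
    by (intro borel_measurable_sum borel_measurable_times borel_measurable_const
        borel_measurable_indicator A)
  have b1: "\<beta> / T ^ i \<le> 1" "0 < \<beta> / T ^ i" for i :: nat
    using \<beta> T one_le_power[of T i] by (auto simp: divide_le_eq intro: order_trans)
  fix B assume B: "B \<in> sets unit_leb"
  define b where "b = measure unit_leb B"
  have b: "0 \<le> b" "b \<le> 1" by (simp_all add: b_def)
  define I where "I = {i \<in> {1..n}. \<beta> / T ^ i \<le> b}"
  define J where "J = {i \<in> {1..n}. b < \<beta> / T ^ i}"
  let ?t = "\<lambda>i. 1 / \<phi> (\<beta> / T ^ i) * measure unit_leb (A i \<inter> B)"
  have "(\<Sum>i\<in>I. ?t i) \<le> tilde \<phi> b / (1 - q)"
  proof (cases "I = {}")
    case True
    then show ?thesis using tilde_nonneg[OF b] q by simp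
  next
    case False
    \<comment> \<open>The measures decrease with the index, so \<open>m\<close> belongs to the
      largest set of measure at most \<open>b\<close>, and the geometric bound at \<open>m\<close>
      is controlled by \<open>tilde \<phi> b\<close>.\<close>
    define m where "m = Min I"
    have "finite I" by (simp add: I_def)
    then have "m \<in> I" "\<And>i. i \<in> I \<Longrightarrow> m \<le> i" using False by (simp_all add: m_def)
    then have m: "m \<in> I" "I \<subseteq> {m..n}" by (auto simp: I_def)
    have "(\<Sum>i\<in>I. ?t i) \<le> (\<Sum>i\<in>I. tilde \<phi> (\<beta> / T ^ i))"
    proof (rule sum_mono)
      fix i assume "i \<in> I"
      then have i: "i \<in> {1..n}" by (simp add: I_def)
      have "measure unit_leb (A i \<inter> B) \<le> \<beta> / T ^ i"
        unfolding mA[OF i, symmetric] using A[OF i] by (intro unit_leb.finite_measure_mono) auto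
      then have "measure unit_leb (A i \<inter> B) / \<phi> (\<beta> / T ^ i) \<le> tilde \<phi> (\<beta> / T ^ i)"
        unfolding tilde_def
        by (rule divide_right_mono) (rule less_imp_le[OF phi_gt_0[OF b1(2) b1(1)]])
      then show "?t i \<le> tilde \<phi> (\<beta> / T ^ i)" by simp
    qed
    also have "\<dots> \<le> (\<Sum>i=m..n. tilde \<phi> (\<beta> / T ^ i))"
      using m b1 by (intro sum_mono2) (auto intro!: tilde_nonneg intro: less_imp_le)
    also have "\<dots> \<le> tilde \<phi> (\<beta> / T ^ m) / (1 - q)"
      using m by (intro sum_tilde_geometric_le[OF T q contr \<beta>]) (auto simp: I_def)
    also have "\<dots> \<le> tilde \<phi> b / (1 - q)"
      using m b b1[of m] q by (intro divide_right_mono tilde_mono) (auto simp: I_def intro: less_imp_le)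
    finally show ?thesis .
  qed
  moreover have "(\<Sum>i\<in>J. ?t i) \<le> tilde \<phi> b"
  proof (cases "b = 0")
    case True
    have "measure unit_leb (A i \<inter> B) = 0" for i
      using unit_leb.finite_measure_mono[OF Int_lower2 B, of "A i"] True
      by (simp add: b_def measure_le_0_iff)
    then show ?thesis using True by simp
  next
    case False
    with b have b0: "0 < b" by simp
    have "(\<Sum>i\<in>J. ?t i) \<le> (\<Sum>i\<in>J. 1 / \<phi> b * measure unit_leb (A i \<inter> B))"
    proof (rule sum_mono)
      fix i assume "i \<in> J"
      then have "b \<le> \<beta> / T ^ i" by (simp add: J_def)
      then have "\<phi> b \<le> \<phi> (\<beta> / T ^ i)" using b b1[of i] by (intro phi_le) auto
      then have "1 / \<phi> (\<beta> / T ^ i) \<le> 1 / \<phi> b"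
        using phi_gt_0[OF b0 b(2)] by (simp add: frac_le)
      then show "?t i \<le> 1 / \<phi> b * measure unit_leb (A i \<inter> B)"
        by (rule mult_right_mono) simp
    qed
    also have "\<dots> = 1 / \<phi> b * (\<Sum>i\<in>J. measure unit_leb (A i \<inter> B))"
      by (simp only: sum_distrib_left)
    also have "(\<Sum>i\<in>J. measure unit_leb (A i \<inter> B)) = measure unit_leb (\<Union>i\<in>J. A i \<inter> B)"
    proof (rule unit_leb.finite_measure_finite_Union[symmetric])
      show "disjoint_family_on (\<lambda>i. A i \<inter> B) J"
        using disj unfolding disjoint_family_on_def J_def by blast
    qed (use A B in \<open>auto simp: J_def\<close>)
    also have "1 / \<phi> b * measure unit_leb (\<Union>i\<in>J. A i \<inter> B) \<le> 1 / \<phi> b * b"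
      unfolding b_def using B phi_gt_0[OF b0 b(2)]
      by (intro mult_left_mono unit_leb.finite_measure_mono) (auto simp: b_def)
    finally show ?thesis by (simp add: tilde_def)
  qed
  moreover have "(\<Sum>i=1..n. ?t i) = (\<Sum>i\<in>I. ?t i) + (\<Sum>i\<in>J. ?t i)"
  proof -
    have eq: "{1..n} = I \<union> J" by (auto simp: I_def J_def)
    show ?thesis unfolding eq by (rule sum.union_disjoint) (auto simp: I_def J_def)
  qed
  ultimately have "(\<Sum>i=1..n. ?t i) \<le> (1 + 1 / (1 - q)) * tilde \<phi> b"
    by (simp add: algebra_simps)
  then have "ennreal (\<Sum>i=1..n. ?t i) \<le> ennreal (1 + 1 / (1 - q)) * ennreal (tilde \<phi> b)"
    using q tilde_nonneg[OF b] by (subst ennreal_mult[symmetric]) (auto intro: ennreal_leI)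
  moreover have "(\<integral>\<^sup>+ u\<in>B. ennreal \<bar>\<Sum>i=1..n. 1 / \<phi> (\<beta> / T ^ i) * indicator (A i) u\<bar> \<partial>unit_leb)
      = ennreal (\<Sum>i=1..n. ?t i)"
    using phi_gt_0[OF b1(2) b1(1)] by (intro set_nn_integral_sum_indicators A B) (auto intro: less_imp_le)
  ultimately show "(\<integral>\<^sup>+ u\<in>B. ennreal \<bar>\<Sum>i=1..n. 1 / \<phi> (\<beta> / T ^ i) * indicator (A i) u\<bar> \<partial>unit_leb)
      \<le> ennreal (1 + 1 / (1 - q)) * ennreal (tilde \<phi> (measure unit_leb B))"
    by (simp add: b_def)
qed

text \<open>Both families consist of normalized indicators inside the same level sets:
  \<open>y i\<close> on a set of measure \<open>t i\<close>, \<open>x i\<close> on one of measure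
  \<open>\<beta> / T ^ i\<close>. All norms are \<open>1\<close>, and the sum of the
  \<open>x i\<close> has norm bounded independently of \<open>n\<close>, so decomposability bounds
  the sum of the \<open>y i\<close>.\<close>

lemma sum_tilde_le_spaced_levels:
  assumes w: "w \<in> borel_measurable unit_leb"
    and C: "0 < C" "\<And>x y :: nat \<Rightarrow> real \<Rightarrow> real.
      (\<forall>i\<in>{1..n}. x i \<in> marcinkiewicz_space \<phi> \<and> y i \<in> marcinkiewicz_space \<phi> \<and>
        nonzero_fun (x i) \<and> nonzero_fun (y i) \<and>
        marcinkiewicz_norm \<phi> (x i) = marcinkiewicz_norm \<phi> (y i)) \<Longrightarrow>
      (\<forall>i\<in>{1..<n}. 2 * ess_sup_on (supp (x (i + 1)) \<union> supp (y (i + 1))) w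
        \<le> ess_inf_on (supp (x i) \<union> supp (y i)) w) \<Longrightarrow>
      marcinkiewicz_norm \<phi> (\<lambda>t. \<Sum>i=1..n. y i t) \<le>
        ennreal C * marcinkiewicz_norm \<phi> (\<lambda>t. \<Sum>i=1..n. x i t)"
    and T: "1 < T" and q: "0 < q" "q < 1"
    and contr: "\<And>s. 0 < s \<Longrightarrow> s * T \<le> 1 \<Longrightarrow> tilde \<phi> s \<le> q * tilde \<phi> (s * T)"
    and gap: "\<And>i j. 1 \<le> i \<Longrightarrow> i < j \<Longrightarrow> j \<le> n \<Longrightarrow> k j + 2 \<le> k i"
    and t: "\<And>i. i \<in> {1..n} \<Longrightarrow> 0 < t i"
      "\<And>i. i \<in> {1..n} \<Longrightarrow> t i \<le> measure unit_leb (level_set w (k i))"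
  shows "(\<Sum>i=1..n. tilde \<phi> (t i)) \<le> C * (1 + 1 / (1 - q)) * tilde \<phi> (\<Sum>i=1..n. t i)"
proof -
  \<comment> \<open>Taking the minimum of all \<open>t i\<close> makes
    \<open>\<beta> / T ^ i\<close> fit into every level set; the inserted \<open>1\<close> gives
    \<open>\<beta> \<le> 1\<close>, also for an empty family.\<close>
  define \<beta> where "\<beta> = Min (insert 1 (t ` {1..n}))"
  have "\<beta> \<in> insert 1 (t ` {1..n})" unfolding \<beta>_def by (rule Min_in) auto
  moreover have "\<beta> \<le> 1" "\<And>i. i \<in> {1..n} \<Longrightarrow> \<beta> \<le> t i"
    unfolding \<beta>_def by (rule Min_le; simp)+
  ultimately have \<beta>: "0 < \<beta>" "\<beta> \<le> 1" "\<And>i. i \<in> {1..n} \<Longrightarrow> \<beta> \<le> t i"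
    using t(1) by auto
  let ?b = "\<lambda>i. \<beta> / T ^ i"
  have b: "0 < ?b i" "?b i \<le> \<beta>" "?b i \<le> 1" for i
  proof -
    have "1 \<le> T ^ i" using T by (intro one_le_power) simp
    then show "0 < ?b i" "?b i \<le> \<beta>" using \<beta> T by (auto simp: divide_le_eq mult_le_cancel_left1)
    then show "?b i \<le> 1" using \<beta> by simp
  qed
  have ex: "\<exists>A\<in>sets unit_leb. A \<subseteq> level_set w (k i) \<and> measure unit_leb A = s"
    if "0 \<le> s" "s \<le> measure unit_leb (level_set w (k i))" for s i
    using exists_intermediate_measure[OF _ level_set_sets[OF w], of "{}" "k i" s] that by auto
  have "\<forall>i\<in>{1..n}. \<exists>A. A \<in> sets unit_leb \<and> A \<subseteq> level_set w (k i) \<and> measure unit_leb A = t i"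
    using ex t by (meson less_imp_le)
  then obtain A where A: "\<And>i. i \<in> {1..n} \<Longrightarrow> A i \<in> sets unit_leb"
    "\<And>i. i \<in> {1..n} \<Longrightarrow> A i \<subseteq> level_set w (k i)"
    "\<And>i. i \<in> {1..n} \<Longrightarrow> measure unit_leb (A i) = t i"
    by metis
  have "\<forall>i\<in>{1..n}. \<exists>A. A \<in> sets unit_leb \<and> A \<subseteq> level_set w (k i) \<and> measure unit_leb A = ?b i"
  proof
    fix i assume i: "i \<in> {1..n}"
    have "?b i \<le> measure unit_leb (level_set w (k i))"
      using b(2)[of i] \<beta>(3)[OF i] t(2)[OF i] by linarith
    then show "\<exists>A. A \<in> sets unit_leb \<and> A \<subseteq> level_set w (k i) \<and> measure unit_leb A = ?b i"
      using ex[of "?b i" i] b(1)[of i] by (meson less_imp_le)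
  qed
  then obtain B where B: "\<And>i. i \<in> {1..n} \<Longrightarrow> B i \<in> sets unit_leb"
    "\<And>i. i \<in> {1..n} \<Longrightarrow> B i \<subseteq> level_set w (k i)"
    "\<And>i. i \<in> {1..n} \<Longrightarrow> measure unit_leb (B i) = ?b i"
    by metis
  have kneq: "k i \<noteq> k j" if "i \<in> {1..n}" "j \<in> {1..n}" "i \<noteq> j" for i j
    using gap[of i j] gap[of j i] that by (cases "i < j") auto
  have disj: "disjoint_family_on D {1..n}"
    if "\<And>i. i \<in> {1..n} \<Longrightarrow> D i \<subseteq> level_set w (k i)" for D :: "nat \<Rightarrow> real set"
    unfolding disjoint_family_on_def
    using that kneq level_set_disjoint[of _ _ w] by blast
  define x :: "nat \<Rightarrow> real \<Rightarrow> real" where "x i = (\<lambda>u. 1 / \<phi> (?b i) * indicator (B i) u)" for i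
  define y :: "nat \<Rightarrow> real \<Rightarrow> real" where "y i = (\<lambda>u. 1 / \<phi> (t i) * indicator (A i) u)" for i
  have t1: "t i \<le> 1" if "i \<in> {1..n}" for i using A(3)[OF that] by (metis unit_leb.prob_le_1)
  have props: "f \<in> marcinkiewicz_space \<phi>" "nonzero_fun f" "marcinkiewicz_norm \<phi> f = 1"
    "supp f \<subseteq> D"
    if D: "D \<in> sets unit_leb" "measure unit_leb D = s" and s: "0 < s"
      and f: "f = (\<lambda>u. 1 / \<phi> s * indicator D u)" for f D s
  proof -
    have "s \<le> 1" using D(2) by auto
    then have "0 < \<phi> s" using s by (intro phi_gt_0)
    show n1: "marcinkiewicz_norm \<phi> f = 1"
      using norm_normalized_indicator[OF D(1)] D(2) s f by simp
    have "f \<in> borel_measurable unit_leb" unfolding f using D(1) by measurable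
    then show "f \<in> marcinkiewicz_space \<phi>" using n1 by (simp add: marcinkiewicz_space_def)
    show "nonzero_fun f" unfolding f
      using D s \<open>0 < \<phi> s\<close> by (intro nonzero_fun_indicator) auto
    show "supp f \<subseteq> D" unfolding f by (auto simp: supp_def split: split_indicator_asm)
  qed
  have px: "x i \<in> marcinkiewicz_space \<phi>" "nonzero_fun (x i)" "marcinkiewicz_norm \<phi> (x i) = 1"
    "supp (x i) \<subseteq> B i" if "i \<in> {1..n}" for i
    by (rule props[OF B(1)[OF that] B(3)[OF that] b(1) x_def])+
  have py: "y i \<in> marcinkiewicz_space \<phi>" "nonzero_fun (y i)" "marcinkiewicz_norm \<phi> (y i) = 1"
    "supp (y i) \<subseteq> A i" if "i \<in> {1..n}" for i
    by (rule props[OF A(1)[OF that] A(3)[OF that] t(1)[OF that] y_def])+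
  have supp_sets: "supp f \<in> sets unit_leb" if "f \<in> marcinkiewicz_space \<phi>" for f
    using that by (intro sets_supp) (simp add: marcinkiewicz_space_def)
  let ?S = "\<lambda>i. supp (x i) \<union> supp (y i)"
  have S: "?S i \<in> sets unit_leb" "?S i \<subseteq> level_set w (k i)" if "i \<in> {1..n}" for i
    using supp_sets px[OF that] py[OF that] A(2)[OF that] B(2)[OF that] by blast+
  \<comment> \<open>A gap of two levels is what is needed: one factor \<open>2\<close> for the upper
    end of the lower level, another for the factor in the separation condition.\<close>
  have sep: "2 * ess_sup_on (?S (i + 1)) w \<le> ess_inf_on (?S i) w" if i: "i \<in> {1..<n}" for i
  proof -
    have i1: "i \<in> {1..n}" and i2: "i + 1 \<in> {1..n}" using i by auto
    have "2 * ess_sup_on (?S (i + 1)) w \<le> 2 * ereal (2 powi (k (i + 1) + 1))"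
      by (intro ereal_mult_left_mono ess_sup_on_le[OF w S[OF i2]]) simp
    also have "\<dots> = ereal (2 powi (k (i + 1) + 2))"
      by (simp add: power_int_add)
    also have "\<dots> \<le> ereal (2 powi k i)"
      using gap[of i "i + 1"] i by (intro ereal_less_eq(3)[THEN iffD2] power_int_increasing) auto
    also have "\<dots> \<le> ess_inf_on (?S i) w" by (rule le_ess_inf_on[OF w S[OF i1]])
    finally show ?thesis .
  qed
  have "marcinkiewicz_norm \<phi> (\<lambda>u. \<Sum>i=1..n. y i u) \<le>
      ennreal C * marcinkiewicz_norm \<phi> (\<lambda>u. \<Sum>i=1..n. x i u)"
    using px py sep by (intro C(2)) auto
  also have "\<dots> \<le> ennreal C * ennreal (1 + 1 / (1 - q))"
    unfolding x_def
    by (intro mult_left_mono norm_geometric_indicators_le[OF T q contr \<beta>(1,2) B(1) disj B(3)] B(2)) auto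
  also have "\<dots> = ennreal (C * (1 + 1 / (1 - q)))"
    using C(1) q by (intro ennreal_mult[symmetric]) auto
  finally have Ny: "marcinkiewicz_norm \<phi> (\<lambda>u. \<Sum>i=1..n. y i u) \<le> ennreal (C * (1 + 1 / (1 - q)))" .
  let ?U = "\<Union>i\<in>{1..n}. A i"
  have U: "?U \<in> sets unit_leb" using A(1) by auto
  have mU: "measure unit_leb ?U = (\<Sum>i=1..n. t i)"
  proof -
    have "measure unit_leb ?U = (\<Sum>i=1..n. measure unit_leb (A i))"
      using A(1) disj[OF A(2)] by (intro unit_leb.finite_measure_finite_Union) auto
    also have "\<dots> = (\<Sum>i=1..n. t i)" using A(3) by (intro sum.cong) auto
    finally show ?thesis .
  qed
  have my: "(\<lambda>u. \<Sum>i=1..n. y i u) \<in> borel_measurable unit_leb"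
    using py(1) by (intro borel_measurable_sum) (auto simp: marcinkiewicz_space_def)
  \<comment> \<open>The norm is tested on the union of the \<open>A i\<close>, where the
    \<open>i\<close>-th indicator integrates to \<open>t i / \<phi> (t i)\<close>.\<close>
  have "ennreal (\<Sum>i=1..n. tilde \<phi> (t i)) = (\<integral>\<^sup>+ u\<in>?U. ennreal \<bar>\<Sum>i=1..n. y i u\<bar> \<partial>unit_leb)"
  proof -
    have "(\<integral>\<^sup>+ u\<in>?U. ennreal \<bar>\<Sum>i=1..n. y i u\<bar> \<partial>unit_leb) =
        ennreal (\<Sum>i=1..n. 1 / \<phi> (t i) * measure unit_leb (A i \<inter> ?U))"
      unfolding y_def using phi_gt_0[OF t(1) t1]
      by (intro set_nn_integral_sum_indicators A(1) U) (auto intro: less_imp_le)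
    also have "(\<Sum>i=1..n. 1 / \<phi> (t i) * measure unit_leb (A i \<inter> ?U)) = (\<Sum>i=1..n. tilde \<phi> (t i))"
    proof (rule sum.cong)
      fix i assume i: "i \<in> {1..n}"
      then have "A i \<inter> ?U = A i" by blast
      then show "1 / \<phi> (t i) * measure unit_leb (A i \<inter> ?U) = tilde \<phi> (t i)"
        using A(3)[OF i] by (simp add: tilde_def)
    qed simp
    finally show ?thesis by simp
  qed
  also have "\<dots> \<le> marcinkiewicz_norm \<phi> (\<lambda>u. \<Sum>i=1..n. y i u) * ennreal (tilde \<phi> (measure unit_leb ?U))"
    by (rule set_nn_integral_le_norm[OF my U])
  also have "\<dots> \<le> ennreal (C * (1 + 1 / (1 - q))) * ennreal (tilde \<phi> (measure unit_leb ?U))"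
    by (intro mult_right_mono Ny) simp
  also have "\<dots> = ennreal (C * (1 + 1 / (1 - q)) * tilde \<phi> (\<Sum>i=1..n. t i))"
    unfolding mU using C(1) q mU tilde_nonneg[OF measure_nonneg unit_leb.prob_le_1, of ?U]
    by (intro ennreal_mult[symmetric]) auto
  finally show ?thesis
  proof (rule ennreal_le_iff[THEN iffD1, rotated])
    show "0 \<le> C * (1 + 1 / (1 - q)) * tilde \<phi> (\<Sum>i=1..n. t i)"
      using C(1) q mU tilde_nonneg[OF measure_nonneg unit_leb.prob_le_1, of ?U]
      by (intro mult_nonneg_nonneg) auto
  qed
qed

text \<open>Distinct integers of equal parity differ by at least \<open>2\<close>, so listing the
  levels of \<open>F\<close> in decreasing order meets the gap condition.\<close>

lemma sum_tilde_le_same_parity: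
  assumes w: "w \<in> borel_measurable unit_leb"
    and dec: "0 < C" "\<And>n (x :: nat \<Rightarrow> real \<Rightarrow> real) y. 1 \<le> n \<Longrightarrow>
      (\<forall>i\<in>{1..n}. x i \<in> marcinkiewicz_space \<phi> \<and> y i \<in> marcinkiewicz_space \<phi> \<and>
        nonzero_fun (x i) \<and> nonzero_fun (y i) \<and>
        marcinkiewicz_norm \<phi> (x i) = marcinkiewicz_norm \<phi> (y i)) \<Longrightarrow>
      (\<forall>i\<in>{1..<n}. 2 * ess_sup_on (supp (x (i + 1)) \<union> supp (y (i + 1))) w
        \<le> ess_inf_on (supp (x i) \<union> supp (y i)) w) \<Longrightarrow>
      marcinkiewicz_norm \<phi> (\<lambda>t. \<Sum>i=1..n. y i t) \<le>
        ennreal C * marcinkiewicz_norm \<phi> (\<lambda>t. \<Sum>i=1..n. x i t)"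
    and T: "1 < T" and q: "0 < q" "q < 1"
    and contr: "\<And>s. 0 < s \<Longrightarrow> s * T \<le> 1 \<Longrightarrow> tilde \<phi> s \<le> q * tilde \<phi> (s * T)"
    and "finite F" and par: "\<And>k k'. k \<in> F \<Longrightarrow> k' \<in> F \<Longrightarrow> even (k - k')"
    and t: "\<And>k. k \<in> F \<Longrightarrow> 0 < t k" "\<And>k. k \<in> F \<Longrightarrow> t k \<le> measure unit_leb (level_set w k)"
  shows "(\<Sum>k\<in>F. tilde \<phi> (t k)) \<le> C * (1 + 1 / (1 - q)) * tilde \<phi> (\<Sum>k\<in>F. t k)"
proof (cases "F = {}")
  case False
  \<comment> \<open>Decreasing order, because decomposability puts the set with the larger weight
    first.\<close>
  define xs where "xs = rev (sorted_list_of_set F)"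
  define n where "n = card F"
  have n: "1 \<le> n" using False \<open>finite F\<close> by (simp add: n_def Suc_le_eq card_gt_0_iff)
  have xs: "set xs = F" "distinct xs" "length xs = n"
    using \<open>finite F\<close> by (simp_all add: xs_def n_def)
  have sorted: "sorted_wrt (>) xs"
    by (simp add: xs_def sorted_wrt_rev)
  \<comment> \<open>Lists are indexed from \<open>0\<close>, the families in decomposability from
    \<open>1\<close>.\<close>
  define k where "k i = xs ! (i - 1)" for i
  have kF: "k i \<in> F" if "i \<in> {1..n}" for i
    using that xs nth_mem[of "i - 1" xs] by (auto simp: k_def)
  have gap: "k j + 2 \<le> k i" if "1 \<le> i" "i < j" "j \<le> n" for i j
  proof -
    have "k j < k i"
      using sorted_wrt_nth_less[OF sorted, of "i - 1" "j - 1"] that xs(3) by (simp add: k_def)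
    moreover have "even (k i - k j)" using that by (intro par kF) auto
    ultimately show ?thesis by presburger
  qed
  have reindex: "(\<Sum>i=1..n. g (k i)) = sum g F" for g :: "int \<Rightarrow> real"
  proof -
    have "(\<Sum>i=1..n. g (k i)) = (\<Sum>i<n. g (xs ! i))"
      by (rule sum.reindex_bij_witness[of _ Suc "\<lambda>i. i - 1"]) (auto simp: k_def)
    also have "\<dots> = sum g F"
      using sum.list_conv_set_nth[of "map g xs"] sum.distinct_set_conv_list[OF xs(2), of g] xs
      by (simp add: sum_list_sum_nth atLeast0LessThan)
    finally show ?thesis .
  qed
  have "(\<Sum>i=1..n. tilde \<phi> (t (k i))) \<le>
      C * (1 + 1 / (1 - q)) * tilde \<phi> (\<Sum>i=1..n. t (k i))"
    using t kF by (intro sum_tilde_le_spaced_levels[OF w dec(1) dec(2)[OF n] T q contr gap]) auto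
  then show ?thesis unfolding reindex[of "\<lambda>j. tilde \<phi> (t j)"] reindex[of t] .
qed simp

text \<open>The lower estimate is countable subadditivity. For the upper one, the levels in a
  partial sum are split into even and odd ones, and each half is bounded by the equal-parity
  estimate.\<close>

lemma sum_tilde_le_of_decomposable:
  assumes w: "nontrivial_weight w" and index: "upper_dilation_index \<phi> < 1"
    and dec: "w_decomposable w (marcinkiewicz_space \<phi>) (marcinkiewicz_norm \<phi>)"
  shows "\<exists>C>0. \<forall>\<tau>. (\<forall>r. 0 < \<tau> r \<and> \<tau> r \<le> weight_seq w r) \<longrightarrow>
    ennreal (1 / C * tilde \<phi> (\<Sum>r. \<tau> r)) \<le> (\<Sum>r. ennreal (tilde \<phi> (\<tau> r))) \<and>
    (\<Sum>r. ennreal (tilde \<phi> (\<tau> r))) \<le> ennreal (C * tilde \<phi> (\<Sum>r. \<tau> r))"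
proof -
  have wm: "w \<in> borel_measurable unit_leb"
    using w by (simp add: nontrivial_weight_def weight_def)
  obtain \<kappa> where \<kappa>: "inj \<kappa>" "\<And>r. weight_seq w r = measure unit_leb (level_set w (\<kappa> r))"
    "AE t in unit_leb. \<exists>r. t \<in> level_set w (\<kappa> r)"
    using level_set_enumeration[OF w] by blast
  obtain C0 where C0: "0 < C0" "\<And>n (x :: nat \<Rightarrow> real \<Rightarrow> real) y. 1 \<le> n \<Longrightarrow>
      (\<forall>i\<in>{1..n}. x i \<in> marcinkiewicz_space \<phi> \<and> y i \<in> marcinkiewicz_space \<phi> \<and>
        nonzero_fun (x i) \<and> nonzero_fun (y i) \<and>
        marcinkiewicz_norm \<phi> (x i) = marcinkiewicz_norm \<phi> (y i)) \<Longrightarrow>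
      (\<forall>i\<in>{1..<n}. 2 * ess_sup_on (supp (x (i + 1)) \<union> supp (y (i + 1))) w
        \<le> ess_inf_on (supp (x i) \<union> supp (y i)) w) \<Longrightarrow>
      marcinkiewicz_norm \<phi> (\<lambda>t. \<Sum>i=1..n. y i t) \<le>
        ennreal C0 * marcinkiewicz_norm \<phi> (\<lambda>t. \<Sum>i=1..n. x i t)"
    using w_decomposableE[OF dec] by blast
  obtain T q where Tq: "1 < T" "0 < q" "q < 1"
    "\<And>s. 0 < s \<Longrightarrow> s * T \<le> 1 \<Longrightarrow> tilde \<phi> s \<le> q * tilde \<phi> (s * T)"
    using exists_tilde_contraction[OF index] by blast
  define K where "K = C0 * (1 + 1 / (1 - q))"
  have K: "0 < K" using C0 Tq by (auto simp: K_def intro!: mult_pos_pos add_pos_pos)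
  \<comment> \<open>\<open>1\<close> serves the lower estimate, \<open>2 * K\<close> the two parity
    classes.\<close>
  define C where "C = max 1 (2 * K)"
  have C: "1 \<le> C" "2 * K \<le> C" "0 < C" by (auto simp: C_def)
  note ws = weight_seq_sums[OF wm \<kappa>(1,3,2)]
  have "ennreal (1 / C * tilde \<phi> (\<Sum>r. \<tau> r)) \<le> (\<Sum>r. ennreal (tilde \<phi> (\<tau> r))) \<and>
      (\<Sum>r. ennreal (tilde \<phi> (\<tau> r))) \<le> ennreal (C * tilde \<phi> (\<Sum>r. \<tau> r))"
    if \<tau>: "\<forall>r. 0 < \<tau> r \<and> \<tau> r \<le> weight_seq w r" for \<tau>
  proof
    have nn: "0 \<le> \<tau> r" for r using \<tau> by (simp add: less_imp_le)
    have sm: "summable \<tau>"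
      by (rule summable_comparison_test'[OF sums_summable[OF ws], of 0]) (use \<tau> nn in auto)
    have "(\<Sum>r. \<tau> r) \<le> (\<Sum>r. weight_seq w r)"
      using \<tau> sm sums_summable[OF ws] by (intro suminf_le) auto
    also have "\<dots> \<le> 1" using sums_unique[OF ws] by simp
    finally have s1: "(\<Sum>r. \<tau> r) \<le> 1" .
    have s0: "0 \<le> (\<Sum>r. \<tau> r)" using sm nn by (rule suminf_nonneg)
    let ?s = "tilde \<phi> (\<Sum>r. \<tau> r)"
    have "1 / C * ?s \<le> 1 * ?s"
      using C tilde_nonneg[OF s0 s1] by (intro mult_right_mono) auto
    then have "ennreal (1 / C * ?s) \<le> ennreal ?s" by (simp add: ennreal_leI)
    also have "\<dots> \<le> (\<Sum>r. ennreal (tilde \<phi> (\<tau> r)))" by (rule tilde_suminf_le[OF nn sm s1])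
    finally show "ennreal (1 / C * ?s) \<le> (\<Sum>r. ennreal (tilde \<phi> (\<tau> r)))" .
    \<comment> \<open>The sequence is indexed anew by levels, since order and parity refer to the
      level rather than to its rank in the rearrangement.\<close>
    define t where "t j = \<tau> (inv \<kappa> j)" for j
    have t\<kappa>: "t (\<kappa> r) = \<tau> r" for r using \<kappa>(1) by (simp add: t_def)
    show "(\<Sum>r. ennreal (tilde \<phi> (\<tau> r))) \<le> ennreal (C * ?s)"
    \<comment> \<open>Decomposability concerns finite families, so the partial sums are bounded
      uniformly in \<open>N\<close>.\<close>
    proof (rule suminf_le_const)
      fix N
      define F where "F = \<kappa> ` {..<N}"
      have F: "finite F" "F \<subseteq> range \<kappa>" by (auto simp: F_def)
      have tF: "0 < t j" "t j \<le> measure unit_leb (level_set w j)" if j: "j \<in> F" for j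
      proof -
        obtain r where "j = \<kappa> r" using j F by blast
        then show "0 < t j" "t j \<le> measure unit_leb (level_set w j)"
          using \<tau>[rule_format, of r] \<kappa>(2)[of r] by (simp_all add: t\<kappa>)
      qed
      have sumF: "sum t F = (\<Sum>r<N. \<tau> r)"
        unfolding F_def using \<kappa>(1) by (subst sum.reindex) (auto simp: t\<kappa> inj_on_def)
      have le: "sum t F \<le> (\<Sum>r. \<tau> r)"
        unfolding sumF using sm nn by (intro sum_le_suminf) auto
      have part: "(\<Sum>j\<in>G. tilde \<phi> (t j)) \<le> K * ?s"
        if G: "G \<subseteq> F" "\<And>j j'. j \<in> G \<Longrightarrow> j' \<in> G \<Longrightarrow> even (j - j')" for G
      proof -
        have "finite G" using G(1) F(1) by (rule finite_subset)
        have "(\<Sum>j\<in>G. tilde \<phi> (t j)) \<le> K * tilde \<phi> (sum t G)"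
          unfolding K_def using G tF
          by (intro sum_tilde_le_same_parity[OF wm C0 Tq \<open>finite G\<close> G(2)]) auto
        also have "\<dots> \<le> K * ?s"
        proof (intro mult_left_mono tilde_mono)
          have "sum t G \<le> sum t F" using G(1) F(1) tF by (intro sum_mono2) (auto intro: less_imp_le)
          then show "sum t G \<le> (\<Sum>r. \<tau> r)" using le by simp
          show "0 \<le> sum t G" using G(1) tF by (intro sum_nonneg) (auto intro: less_imp_le)
        qed (use K s1 in auto)
        finally show ?thesis .
      qed
      have "(\<Sum>r<N. tilde \<phi> (\<tau> r)) = (\<Sum>j\<in>F. tilde \<phi> (t j))"
        unfolding F_def using \<kappa>(1) by (subst sum.reindex) (auto simp: t\<kappa> inj_on_def)
      also have "F = {j \<in> F. even j} \<union> {j \<in> F. odd j}" by auto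
      also have "(\<Sum>j\<in>{j \<in> F. even j} \<union> {j \<in> F. odd j}. tilde \<phi> (t j)) =
          (\<Sum>j\<in>{j \<in> F. even j}. tilde \<phi> (t j)) + (\<Sum>j\<in>{j \<in> F. odd j}. tilde \<phi> (t j))"
        using F(1) by (intro sum.union_disjoint) auto
      also have "\<dots> \<le> K * ?s + K * ?s" by (intro add_mono part) auto
      also have "\<dots> = 2 * K * ?s" by simp
      also have "\<dots> \<le> C * ?s" using C(2) tilde_nonneg[OF s0 s1] by (rule mult_right_mono)
      finally have "ennreal (\<Sum>r<N. tilde \<phi> (\<tau> r)) \<le> ennreal (C * ?s)" by (rule ennreal_leI)
      moreover have "0 \<le> tilde \<phi> (\<tau> r)" for r
      proof (rule tilde_nonneg[OF nn])
        have "\<tau> r \<le> (\<Sum>r. \<tau> r)" using sum_le_suminf[OF sm, of "{r}"] nn by simp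
        then show "\<tau> r \<le> 1" using s1 by simp
      qed
      ultimately show "(\<Sum>r<N. ennreal (tilde \<phi> (\<tau> r))) \<le> ennreal (C * ?s)"
        by (simp add: sum_ennreal)
    qed simp
  qed
  then show ?thesis using C(3) by blast
qed

section \<open>Sufficiency\<close>

text \<open>The sum condition is applied to the measures of
  \<open>A \<inter> level_set w (\<kappa> r)\<close> for each test set \<open>A\<close>. Some of
  these may vanish, which costs the factor \<open>2\<close> in the constant.\<close>

lemma decomposable_of_sum_tilde_le:
  assumes nt: "nontrivial_weight w" and "0 < C"
    and H: "\<And>\<tau>. (\<And>r. 0 < \<tau> r \<and> \<tau> r \<le> weight_seq w r) \<Longrightarrow>
      (\<Sum>r. ennreal (tilde \<phi> (\<tau> r))) \<le> ennreal (C * tilde \<phi> (\<Sum>r. \<tau> r))"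
  shows "w_decomposable w (marcinkiewicz_space \<phi>) (marcinkiewicz_norm \<phi>)"
proof -
  have w: "w \<in> borel_measurable unit_leb" and w_pos: "AE t in unit_leb. 0 < w t"
    using nt by (simp_all add: nontrivial_weight_def weight_def)
  obtain \<kappa> where \<kappa>: "inj \<kappa>" "\<And>r. weight_seq w r = measure unit_leb (level_set w (\<kappa> r))"
    "\<And>r. 0 < measure unit_leb (level_set w (\<kappa> r))"
    "AE t in unit_leb. \<exists>r. t \<in> level_set w (\<kappa> r)"
    using level_set_enumeration[OF nt] by blast
  have sums: "(\<lambda>r. measure unit_leb (A \<inter> level_set w (\<kappa> r))) sums measure unit_leb A"
    if "A \<in> sets unit_leb" for A
    by (rule sums_measure_level_sets[OF w \<kappa>(1,4) that])
  note ws = weight_seq_sums[OF w \<kappa>(1,4,2)]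
  have K: "(\<Sum>r. ennreal (tilde \<phi> (measure unit_leb (A \<inter> level_set w (\<kappa> r)))))
      \<le> ennreal (2 * C) * ennreal (tilde \<phi> (measure unit_leb A))" if A: "A \<in> sets unit_leb" for A
  proof -
    have "(\<Sum>r. ennreal (tilde \<phi> (measure unit_leb (A \<inter> level_set w (\<kappa> r)))))
        \<le> ennreal (2 * C * tilde \<phi> (\<Sum>r. measure unit_leb (A \<inter> level_set w (\<kappa> r))))"
    proof (rule sum_tilde_le_with_zeros[where v = "weight_seq w"])
      show "0 < weight_seq w r" for r using \<kappa>(2,3) by simp
      show "summable (weight_seq w)" using ws by (rule sums_summable)
      show "(\<Sum>r. weight_seq w r) \<le> 1"
        using sums_unique[OF ws] by simp
      show "measure unit_leb (A \<inter> level_set w (\<kappa> r)) \<le> weight_seq w r" for r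
        unfolding \<kappa>(2) by (rule unit_leb.finite_measure_mono) (auto intro: level_set_sets[OF w])
    qed (use \<open>0 < C\<close> H in auto)
    also have "\<dots> = ennreal (2 * C) * ennreal (tilde \<phi> (measure unit_leb A))"
      unfolding sums_unique[OF sums[OF A], symmetric]
      using \<open>0 < C\<close> tilde_nonneg[of "measure unit_leb A"] by (intro ennreal_mult) auto
    finally show ?thesis .
  qed
  have "ennreal (1 / (2 * C)) * marcinkiewicz_norm \<phi> (\<lambda>t. \<Sum>i=1..n. x i t)
        \<le> marcinkiewicz_norm \<phi> (\<lambda>t. \<Sum>i=1..n. y i t) \<and>
      marcinkiewicz_norm \<phi> (\<lambda>t. \<Sum>i=1..n. y i t)
        \<le> ennreal (2 * C) * marcinkiewicz_norm \<phi> (\<lambda>t. \<Sum>i=1..n. x i t)"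
    if xy: "\<forall>i\<in>{1..n}. x i \<in> marcinkiewicz_space \<phi> \<and> y i \<in> marcinkiewicz_space \<phi> \<and>
        nonzero_fun (x i) \<and> nonzero_fun (y i) \<and>
        marcinkiewicz_norm \<phi> (x i) = marcinkiewicz_norm \<phi> (y i)"
      and sep: "\<forall>i\<in>{1..<n}. 2 * ess_sup_on (supp (x (i + 1)) \<union> supp (y (i + 1))) w
        \<le> ess_inf_on (supp (x i) \<union> supp (y i)) w" for n and x y :: "nat \<Rightarrow> real \<Rightarrow> real"
  proof
    let ?S = "\<lambda>i. supp (x i) \<union> supp (y i)"
    have mx: "x i \<in> borel_measurable unit_leb" and my: "y i \<in> borel_measurable unit_leb"
      and N: "marcinkiewicz_norm \<phi> (x i) = marcinkiewicz_norm \<phi> (y i)" if "i \<in> {1..n}" for i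
      using xy that by (auto simp: marcinkiewicz_space_def)
    have fam: "separated_family w n ?S"
    proof
      fix i assume i: "i \<in> {1..n}"
      show S: "?S i \<in> sets unit_leb" using sets_supp mx[OF i] my[OF i] by blast
      show "0 < measure unit_leb (?S i)"
      proof (rule ccontr)
        assume "\<not> ?thesis"
        then have "measure unit_leb (?S i) = 0" by (simp add: zero_less_measure_iff)
        then have "AE u in unit_leb. u \<notin> ?S i" using unit_leb.prob_eq_0[OF S] by simp
        then have "AE u in unit_leb. x i u = 0" using AE_space
          by eventually_elim (auto simp: supp_def)
        then show False using xy i by (simp add: nonzero_fun_def)
      qed
    qed (use w w_pos sep in auto)
    show "marcinkiewicz_norm \<phi> (\<lambda>t. \<Sum>i=1..n. y i t)
        \<le> ennreal (2 * C) * marcinkiewicz_norm \<phi> (\<lambda>t. \<Sum>i=1..n. x i t)"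
      by (rule norm_sum_le_norm_sum[OF fam \<kappa>(1,4) mx my _ _ _ K]) (auto simp: N)
    \<comment> \<open>The situation is symmetric in \<open>x\<close> and \<open>y\<close>; dividing
      by the constant turns this into the lower estimate.\<close>
    have "marcinkiewicz_norm \<phi> (\<lambda>t. \<Sum>i=1..n. x i t)
        \<le> ennreal (2 * C) * marcinkiewicz_norm \<phi> (\<lambda>t. \<Sum>i=1..n. y i t)"
      by (rule norm_sum_le_norm_sum[OF fam \<kappa>(1,4) my mx _ _ _ K]) (auto simp: N)
    then have "ennreal (1 / (2 * C)) * marcinkiewicz_norm \<phi> (\<lambda>t. \<Sum>i=1..n. x i t) \<le>
        ennreal (1 / (2 * C)) * (ennreal (2 * C) * marcinkiewicz_norm \<phi> (\<lambda>t. \<Sum>i=1..n. y i t))"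
      by (rule mult_left_mono) simp
    also have "\<dots> = ennreal (1 / (2 * C) * (2 * C)) * marcinkiewicz_norm \<phi> (\<lambda>t. \<Sum>i=1..n. y i t)"
      using \<open>0 < C\<close> by (subst ennreal_mult) (auto simp: mult.assoc)
    also have "\<dots> = marcinkiewicz_norm \<phi> (\<lambda>t. \<Sum>i=1..n. y i t)" using \<open>0 < C\<close> by simp
    finally show "ennreal (1 / (2 * C)) * marcinkiewicz_norm \<phi> (\<lambda>t. \<Sum>i=1..n. x i t)
        \<le> marcinkiewicz_norm \<phi> (\<lambda>t. \<Sum>i=1..n. y i t)" .
  qed
  then show ?thesis
    unfolding w_decomposable_def using \<open>0 < C\<close> by (intro exI[of _ "2 * C"]) auto
qed

end

theorem corollary4p9:
  fixes \<phi> w :: "real \<Rightarrow> real"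
  assumes "mono_on {0..1} \<phi>" and "concave_on {0..1} \<phi>" and "\<phi> 0 = 0"
    and "\<forall>t\<in>{0<..1}. 0 < \<phi> t"
    and "upper_dilation_index \<phi> < 1"
    and "nontrivial_weight w"
  shows "w_decomposable w (marcinkiewicz_space \<phi>) (marcinkiewicz_norm \<phi>) \<longleftrightarrow>
    (\<exists>C::real. 0 < C \<and>
      (\<forall>\<tau> :: nat \<Rightarrow> real. (\<forall>r. 0 < \<tau> r \<and> \<tau> r \<le> weight_seq w r) \<longrightarrow>
         ennreal (1 / C * tilde \<phi> (\<Sum>r. \<tau> r)) \<le> (\<Sum>r. ennreal (tilde \<phi> (\<tau> r))) \<and>
         (\<Sum>r. ennreal (tilde \<phi> (\<tau> r))) \<le> ennreal (C * tilde \<phi> (\<Sum>r. \<tau> r))))"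
proof -
  interpret marcinkiewicz_function \<phi> using assms by unfold_locales
  show ?thesis
  proof
    assume "w_decomposable w (marcinkiewicz_space \<phi>) (marcinkiewicz_norm \<phi>)"
    from sum_tilde_le_of_decomposable[OF assms(6,5) this]
    show "\<exists>C::real. 0 < C \<and>
      (\<forall>\<tau> :: nat \<Rightarrow> real. (\<forall>r. 0 < \<tau> r \<and> \<tau> r \<le> weight_seq w r) \<longrightarrow>
         ennreal (1 / C * tilde \<phi> (\<Sum>r. \<tau> r)) \<le> (\<Sum>r. ennreal (tilde \<phi> (\<tau> r))) \<and>
         (\<Sum>r. ennreal (tilde \<phi> (\<tau> r))) \<le> ennreal (C * tilde \<phi> (\<Sum>r. \<tau> r)))" .
  next
    assume "\<exists>C::real. 0 < C \<and>
      (\<forall>\<tau> :: nat \<Rightarrow> real. (\<forall>r. 0 < \<tau> r \<and> \<tau> r \<le> weight_seq w r) \<longrightarrow>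
         ennreal (1 / C * tilde \<phi> (\<Sum>r. \<tau> r)) \<le> (\<Sum>r. ennreal (tilde \<phi> (\<tau> r))) \<and>
         (\<Sum>r. ennreal (tilde \<phi> (\<tau> r))) \<le> ennreal (C * tilde \<phi> (\<Sum>r. \<tau> r)))"
    then obtain C where "0 < C" "\<And>\<tau>. (\<And>r. 0 < \<tau> r \<and> \<tau> r \<le> weight_seq w r) \<Longrightarrow>
        (\<Sum>r. ennreal (tilde \<phi> (\<tau> r))) \<le> ennreal (C * tilde \<phi> (\<Sum>r. \<tau> r))"
      by blast
    then show "w_decomposable w (marcinkiewicz_space \<phi>) (marcinkiewicz_norm \<phi>)"
      by (rule decomposable_of_sum_tilde_le[OF assms(6)])
  qed
qed

end
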